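(* Let $\mathcal{A}$ be a complete discrete valuation ring with fraction field $\mathcal{K}$ and residue field $k$. Let $N$ be a locally profinite group exhausted by compact subgroups of invertible pro-order in $\mathcal{A}$, and let $\chi:N\to\mathcal{A}^\times$ be a smooth character, with reduction $\chi_k:N\to k^\times$. Let $V$ be a smooth $\mathcal{A}[N]$-module which is torsion free as an $\mathcal{A}$-module and such that $V\otimes_{\mathcal{A}}\mathcal{K}$ has countable dimension over $\mathcal{K}$. Then for all $T\in\mathrm{Hom}_N(V\otimes_{\mathcal{A}}k,\chi_k)$ there exists $\tilde T\in\mathrm{Hom}_N(V,\chi)$ reducing to $T$ over $k$, i.e. such that $T(v\otimes 1)$ is the image of $\tilde T(v)$ in $k$ for all $v\in V$.
   Context: A profinite group $K$ has invertible pro-order in a commutative ring $A$ if $[K:U]$ is invertible in $A$ for every open subgroup $U$ of $K$. The group $N$ is exhausted by compact subgroups of invertible pro-order in $A$ if every compact subset of $N$ is contained in a compact open subgroup of $N$ of invertible pro-order in $A$. A module with $N$-action (or a character) is smooth if each vector has open stabilizer (resp. the character has open kernel). $\mathrm{Hom}_N(V,\chi)$ is the module of $\mathcal{A}$-linear forms $\tilde T:V\to\mathcal{A}$ with $\tilde T(n\cdot v)=\chi(n)\tilde T(v)$, and similarly over $k$. *)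

theory Defs
  imports
    "HOL-Algebra.Algebra"
    "HOL-Analysis.Abstract_Topological_Spaces"
    "HOL-Library.Countable_Set"
    "Jordan_Normal_Form.Missing_VectorSpace"
begin

section \<open>Complete discrete valuation rings\<close>

locale discrete_valuation_ring = principal_domain +
  assumes not_field: "\<not> field R"
    and unique_maximal: "\<exists>!m. maximalideal m R"

definition max_ideal :: "('a, 'b) ring_scheme \<Rightarrow> 'a set"
  where "max_ideal R = (THE m. maximalideal m R)"

text \<open>\<^const>\<open>ideals_set\<close> is the multiplicative monoid of ideals, so \<open>I [^]\<^bsub>ideals_set R\<^esub> n\<close> is the
  \<open>n\<close>-th power of the ideal \<open>I\<close>.  Separatedness of the adic topology is automatic for a
  discrete valuation ring, so completeness means convergence of Cauchy sequences.\<close>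

locale complete_discrete_valuation_ring = discrete_valuation_ring +
  assumes complete:
    "\<And>x :: nat \<Rightarrow> 'a.
       (\<And>i. x i \<in> carrier R) \<Longrightarrow>
       (\<And>n :: nat. \<exists>M. \<forall>i\<ge>M. \<forall>j\<ge>M. x i \<ominus> x j \<in> max_ideal R [^]\<^bsub>ideals_set R\<^esub> n) \<Longrightarrow>
       \<exists>l\<in>carrier R. \<forall>n :: nat. \<exists>M. \<forall>i\<ge>M. x i \<ominus> l \<in> max_ideal R [^]\<^bsub>ideals_set R\<^esub> n"

definition residue_field :: "('a, 'b) ring_scheme \<Rightarrow> 'a set ring"
  where "residue_field R = R Quot max_ideal R"

definition residue_map :: "('a, 'b) ring_scheme \<Rightarrow> 'a \<Rightarrow> 'a set"
  where "residue_map R a = max_ideal R +>\<^bsub>R\<^esub> a"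

definition fraction_field ::
    "('a, 'b) ring_scheme \<Rightarrow> ('c, 'd) ring_scheme \<Rightarrow> ('a \<Rightarrow> 'c) \<Rightarrow> bool"
  where "fraction_field R K \<iota> \<longleftrightarrow>
    field K \<and> \<iota> \<in> ring_hom R K \<and> inj_on \<iota> (carrier R) \<and>
    (\<forall>x\<in>carrier K. \<exists>a\<in>carrier R. \<exists>b\<in>carrier R - {\<zero>\<^bsub>R\<^esub>}. x = \<iota> a \<otimes>\<^bsub>K\<^esub> inv\<^bsub>K\<^esub> (\<iota> b))"


section \<open>Locally profinite groups\<close>

locale topological_group = group G for G (structure) and T +
  assumes topspace_eq: "topspace T = carrier G"
    and continuous_mult: "continuous_map (prod_topology T T) T (\<lambda>(x, y). x \<otimes> y)"
    and continuous_inv: "continuous_map T T (\<lambda>x. inv\<^bsub>G\<^esub> x)"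

locale locally_profinite_group = topological_group +
  assumes Hausdorff: "Hausdorff_space T"
    and compact_open_subgroups:
      "\<And>U. openin T U \<Longrightarrow> \<one> \<in> U \<Longrightarrow>
         \<exists>K. subgroup K G \<and> compactin T K \<and> openin T K \<and> K \<subseteq> U"

text \<open>For a profinite group \<open>K\<close> with topology \<open>T\<close>; \<open>card (rcosets\<^bsub>K\<^esub> U)\<close> is the index of \<open>U\<close> in \<open>K\<close>,
  finite because \<open>K\<close> is compact.\<close>

definition invertible_pro_order ::
    "('a, 'b) ring_scheme \<Rightarrow> ('g, 'e) monoid_scheme \<Rightarrow> 'g topology \<Rightarrow> bool"
  where "invertible_pro_order A K T \<longleftrightarrow>
    (\<forall>U. subgroup U K \<and> openin T U \<longrightarrow> [card (rcosets\<^bsub>K\<^esub> U)] \<cdot>\<^bsub>A\<^esub> \<one>\<^bsub>A\<^esub> \<in> Units A)"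

definition exhausted_by_compact_subgroups ::
    "('a, 'b) ring_scheme \<Rightarrow> ('g, 'e) monoid_scheme \<Rightarrow> 'g topology \<Rightarrow> bool"
  where "exhausted_by_compact_subgroups A N T \<longleftrightarrow>
    (\<forall>C. compactin T C \<longrightarrow>
      (\<exists>K. subgroup K N \<and> compactin T K \<and> openin T K \<and> C \<subseteq> K \<and>
           invertible_pro_order A (N\<lparr>carrier := K\<rparr>) (subtopology T K)))"


section \<open>Tensor products and extension of scalars\<close>

text \<open>\<open>S\<close> as a module over the domain of the ring homomorphism \<open>\<phi>\<close>; for \<open>\<phi> = (\<lambda>r. r)\<close> this is
  \<open>S\<close> as a module over itself.\<close>

definition restrict_scalars :: "('s, 'e) ring_scheme \<Rightarrow> ('r \<Rightarrow> 's) \<Rightarrow> ('r, 's) module"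
  where "restrict_scalars S \<phi> =
    \<lparr>carrier = carrier S, monoid.mult = monoid.mult S, one = one S, ring.zero = ring.zero S, ring.add = ring.add S,
     smult = (\<lambda>r s. \<phi> r \<otimes>\<^bsub>S\<^esub> s)\<rparr>"

definition tensor_relations ::
    "('r, 'b) ring_scheme \<Rightarrow> ('r, 'm, 'c) module_scheme \<Rightarrow> ('r, 'p, 'd) module_scheme
      \<Rightarrow> ('m \<times> 'p \<Rightarrow>\<^sub>0 int) set"
  where "tensor_relations R M P =
    {frag_of (x \<oplus>\<^bsub>M\<^esub> y, p) - frag_of (x, p) - frag_of (y, p) | x y p.
       x \<in> carrier M \<and> y \<in> carrier M \<and> p \<in> carrier P} \<union>
    {frag_of (x, p \<oplus>\<^bsub>P\<^esub> q) - frag_of (x, p) - frag_of (x, q) | x p q.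
       x \<in> carrier M \<and> p \<in> carrier P \<and> q \<in> carrier P} \<union>
    {frag_of (r \<odot>\<^bsub>M\<^esub> x, p) - frag_of (x, r \<odot>\<^bsub>P\<^esub> p) | r x p.
       r \<in> carrier R \<and> x \<in> carrier M \<and> p \<in> carrier P}"

abbreviation tensor_free ::
    "('r, 'm, 'c) module_scheme \<Rightarrow> ('r, 'p, 'd) module_scheme \<Rightarrow> ('m \<times> 'p \<Rightarrow>\<^sub>0 int) monoid"
  where "tensor_free M P \<equiv> free_Abelian_group (carrier M \<times> carrier P)"

definition tensor_null ::
    "('r, 'b) ring_scheme \<Rightarrow> ('r, 'm, 'c) module_scheme \<Rightarrow> ('r, 'p, 'd) module_scheme
      \<Rightarrow> ('m \<times> 'p \<Rightarrow>\<^sub>0 int) set"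
  where "tensor_null R M P = generate (tensor_free M P) (tensor_relations R M P)"

definition tensor_group ::
    "('r, 'b) ring_scheme \<Rightarrow> ('r, 'm, 'c) module_scheme \<Rightarrow> ('r, 'p, 'd) module_scheme
      \<Rightarrow> ('m \<times> 'p \<Rightarrow>\<^sub>0 int) set monoid"
  where "tensor_group R M P = tensor_free M P Mod tensor_null R M P"

definition pure_tensor ::
    "('r, 'b) ring_scheme \<Rightarrow> ('r, 'm, 'c) module_scheme \<Rightarrow> ('r, 'p, 'd) module_scheme
      \<Rightarrow> 'm \<Rightarrow> 'p \<Rightarrow> ('m \<times> 'p \<Rightarrow>\<^sub>0 int) set"
  where "pure_tensor R M P x p = tensor_null R M P #>\<^bsub>tensor_free M P\<^esub> frag_of (x, p)"

text \<open>The endomorphism \<open>f \<otimes> g\<close> induced by endomorphisms \<open>f\<close> of \<open>M\<close> and \<open>g\<close> of \<open>P\<close>; as in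
  \<^const>\<open>rcoset_mult\<close>, the union runs over the representatives of a coset.\<close>

definition tensor_map ::
    "('r, 'b) ring_scheme \<Rightarrow> ('r, 'm, 'c) module_scheme \<Rightarrow> ('r, 'p, 'd) module_scheme
      \<Rightarrow> ('m \<Rightarrow> 'm) \<Rightarrow> ('p \<Rightarrow> 'p)
      \<Rightarrow> ('m \<times> 'p \<Rightarrow>\<^sub>0 int) set \<Rightarrow> ('m \<times> 'p \<Rightarrow>\<^sub>0 int) set"
  where "tensor_map R M P f g C =
    (\<Union>c\<in>C. tensor_null R M P #>\<^bsub>tensor_free M P\<^esub>
             frag_extend (\<lambda>(m, p). frag_of (f m, g p)) c)"

text \<open>The \<open>S\<close>-module \<open>M \<otimes>\<^sub>R S\<close> for a ring homomorphism \<open>\<phi>\<close> from \<open>R\<close> to \<open>S\<close>.  The fields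
  \<open>mult\<close> and \<open>one\<close> of a module record carry no meaning.\<close>

definition base_change ::
    "('r, 'b) ring_scheme \<Rightarrow> ('s, 'e) ring_scheme \<Rightarrow> ('r \<Rightarrow> 's) \<Rightarrow> ('r, 'm, 'c) module_scheme
      \<Rightarrow> ('s, ('m \<times> 's \<Rightarrow>\<^sub>0 int) set) module"
  where "base_change R S \<phi> M =
    \<lparr>carrier = carrier (tensor_group R M (restrict_scalars S \<phi>)),
     monoid.mult = undefined, one = undefined,
     ring.zero = one (tensor_group R M (restrict_scalars S \<phi>)),
     ring.add = monoid.mult (tensor_group R M (restrict_scalars S \<phi>)),
     smult = (\<lambda>s. tensor_map R M (restrict_scalars S \<phi>) (\<lambda>x. x) (\<lambda>t. s \<otimes>\<^bsub>S\<^esub> t))\<rparr>"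

definition base_change_action ::
    "('r, 'b) ring_scheme \<Rightarrow> ('s, 'e) ring_scheme \<Rightarrow> ('r \<Rightarrow> 's) \<Rightarrow> ('r, 'm, 'c) module_scheme
      \<Rightarrow> ('g \<Rightarrow> 'm \<Rightarrow> 'm) \<Rightarrow> 'g \<Rightarrow> ('m \<times> 's \<Rightarrow>\<^sub>0 int) set \<Rightarrow> ('m \<times> 's \<Rightarrow>\<^sub>0 int) set"
  where "base_change_action R S \<phi> M \<rho> n =
    tensor_map R M (restrict_scalars S \<phi>) (\<rho> n) (\<lambda>t. t)"

definition torsion_free :: "('r, 'b) ring_scheme \<Rightarrow> ('r, 'm, 'c) module_scheme \<Rightarrow> bool"
  where "torsion_free R M \<longleftrightarrow>
    (\<forall>a\<in>carrier R. \<forall>x\<in>carrier M. a \<odot>\<^bsub>M\<^esub> x = \<zero>\<^bsub>M\<^esub> \<longrightarrow> a = \<zero>\<^bsub>R\<^esub> \<or> x = \<zero>\<^bsub>M\<^esub>)"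

definition countable_dimension :: "('k, 'b) ring_scheme \<Rightarrow> ('k, 'm, 'c) module_scheme \<Rightarrow> bool"
  where "countable_dimension K W \<longleftrightarrow>
    (\<exists>B. countable B \<and> vectorspace.basis K W B)"


section \<open>Smooth modules and characters\<close>

definition smooth_module ::
    "('a, 'b) ring_scheme \<Rightarrow> ('g, 'e) monoid_scheme \<Rightarrow> 'g topology
      \<Rightarrow> ('a, 'v, 'c) module_scheme \<Rightarrow> ('g \<Rightarrow> 'v \<Rightarrow> 'v) \<Rightarrow> bool"
  where "smooth_module A N T V \<rho> \<longleftrightarrow>
    Module.module A V \<and> group_action N (carrier V) \<rho> \<and>
    (\<forall>n\<in>carrier N. \<rho> n \<in> module_hom A V V) \<and>
    (\<forall>v\<in>carrier V. openin T (stabilizer N \<rho> v))"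

definition smooth_character ::
    "('a, 'b) ring_scheme \<Rightarrow> ('g, 'e) monoid_scheme \<Rightarrow> 'g topology \<Rightarrow> ('g \<Rightarrow> 'a) \<Rightarrow> bool"
  where "smooth_character A N T \<psi> \<longleftrightarrow>
    \<psi> \<in> hom N (units_of A) \<and> openin T (kernel N (units_of A) \<psi>)"

definition equivariant_forms ::
    "('a, 'b) ring_scheme \<Rightarrow> ('g, 'e) monoid_scheme
      \<Rightarrow> ('a, 'v, 'c) module_scheme \<Rightarrow> ('g \<Rightarrow> 'v \<Rightarrow> 'v) \<Rightarrow> ('g \<Rightarrow> 'a) \<Rightarrow> ('v \<Rightarrow> 'a) set"
  where "equivariant_forms A N V \<rho> \<psi> =
    {T \<in> module_hom A V (restrict_scalars A (\<lambda>a. a)).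
       \<forall>n\<in>carrier N. \<forall>v\<in>carrier V. T (\<rho> n v) = \<psi> n \<otimes>\<^bsub>A\<^esub> T v}"


section \<open>Well-definedness of the extension of scalars and of the residue field\<close>

lemma frag_extend_tensor_in:
  assumes "\<And>m p. m \<in> carrier M \<Longrightarrow> p \<in> carrier P \<Longrightarrow> f m \<in> carrier M \<and> g p \<in> carrier P"
    and "c \<in> carrier (tensor_free M P)"
  shows "frag_extend (\<lambda>(m, p). frag_of (f m, g p)) c \<in> carrier (tensor_free M P)"
proof -
  have "Poly_Mapping.keys (frag_extend (\<lambda>(m, p). frag_of (f m, g p)) c)
     \<subseteq> (\<Union>x\<in>Poly_Mapping.keys c. Poly_Mapping.keys ((\<lambda>(m, p). frag_of (f m, g p)) x))"
    by (rule keys_frag_extend)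
  also have "\<dots> \<subseteq> carrier M \<times> carrier P"
    using assms by (fastforce simp: free_Abelian_group_def)
  finally show ?thesis by (simp add: free_Abelian_group_def)
qed

locale tensor_setting = M?: Module.module R M + P?: Module.module R P for R M P
begin

abbreviation "F \<equiv> tensor_free M P"
abbreviation "H \<equiv> tensor_null R M P"

lemma rels_sub: "tensor_relations R M P \<subseteq> carrier F"
  unfolding tensor_relations_def free_Abelian_group_def
  by (auto simp: M.smult_closed P.smult_closed dest!: subsetD[OF keys_diff] split: if_splits)

lemma F_comm: "comm_group F" by (rule abelian_free_Abelian_group)

lemma F_group: "group F" by simp

lemma H_subgroup: "subgroup H F"
  unfolding tensor_null_def using group.generate_is_subgroup[OF F_group rels_sub] .

lemma H_normal: "H \<lhd> F"
  by (rule comm_group.subgroup_imp_normal[OF F_comm H_subgroup])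

lemma H_add: "x \<in> H \<Longrightarrow> y \<in> H \<Longrightarrow> x + y \<in> H"
  using subgroup.m_closed[OF H_subgroup] by (simp add: free_Abelian_group_def)

lemma H_zero: "0 \<in> H"
  using subgroup.one_closed[OF H_subgroup] by (simp add: free_Abelian_group_def)

lemma H_sub: "H \<subseteq> carrier F"
  using subgroup.subset[OF H_subgroup] .

lemma F_inv: "x \<in> carrier F \<Longrightarrow> inv\<^bsub>F\<^esub> x = - x"
  by (rule inv_free_Abelian_group) (simp add: free_Abelian_group_def)

lemma H_minus: "x \<in> H \<Longrightarrow> - x \<in> H"
  using subgroup.m_inv_closed[OF H_subgroup, of x] F_inv[of x] H_sub by auto

lemma H_diff: "x \<in> H \<Longrightarrow> y \<in> H \<Longrightarrow> x - y \<in> H"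
  using H_add[of x "-y"] H_minus by simp

lemma coset_eq: "H #>\<^bsub>F\<^esub> x = {h + x | h. h \<in> H}"
  by (auto simp: r_coset_def free_Abelian_group_def)

lemma coset_eqI: "x - y \<in> H \<Longrightarrow> H #>\<^bsub>F\<^esub> x = H #>\<^bsub>F\<^esub> y"
proof -
  assume a: "x - y \<in> H"
  show ?thesis unfolding coset_eq
  proof (safe, goal_cases)
    case (1 z h) show ?case by (rule exI[of _ "h + (x - y)"]) (use 1 a H_add in auto)
  next
    case (2 z h) show ?case by (rule exI[of _ "h - (x - y)"]) (use 2 a H_diff in auto)
  qed
qed

lemma rel_in_H: "x \<in> tensor_relations R M P \<Longrightarrow> x \<in> H"
  unfolding tensor_null_def by (rule generate.incl)

lemma hom_H:
  assumes f: "\<And>m. m \<in> carrier M \<Longrightarrow> f m \<in> carrier M"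
    "\<And>x y. x \<in> carrier M \<Longrightarrow> y \<in> carrier M \<Longrightarrow> f (x \<oplus>\<^bsub>M\<^esub> y) = f x \<oplus>\<^bsub>M\<^esub> f y"
    "\<And>r x. r \<in> carrier R \<Longrightarrow> x \<in> carrier M \<Longrightarrow> f (r \<odot>\<^bsub>M\<^esub> x) = r \<odot>\<^bsub>M\<^esub> f x"
   and g: "\<And>m. m \<in> carrier P \<Longrightarrow> g m \<in> carrier P"
    "\<And>x y. x \<in> carrier P \<Longrightarrow> y \<in> carrier P \<Longrightarrow> g (x \<oplus>\<^bsub>P\<^esub> y) = g x \<oplus>\<^bsub>P\<^esub> g y"
    "\<And>r x. r \<in> carrier R \<Longrightarrow> x \<in> carrier P \<Longrightarrow> g (r \<odot>\<^bsub>P\<^esub> x) = r \<odot>\<^bsub>P\<^esub> g x"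
  and x: "x \<in> H"
  shows "frag_extend (\<lambda>(m, p). frag_of (f m, g p)) x \<in> H" (is "?e x \<in> H")
proof -
  have rel: "?e x \<in> H" if x: "x \<in> tensor_relations R M P" for x
  proof (rule rel_in_H)
    show "?e x \<in> tensor_relations R M P"
      using x unfolding tensor_relations_def
      apply (elim UnE CollectE exE conjE)
      subgoal for a b p using f g by (intro UnI1 CollectI exI[of _ "f a"] exI[of _ "f b"] exI[of _ "g p"]) (auto simp: frag_extend_diff)
      subgoal for a b p using f g by (intro UnI1[OF UnI2] CollectI exI[of _ "f a"] exI[of _ "g b"] exI[of _ "g p"]) (auto simp: frag_extend_diff)
      subgoal for a b p using f g by (intro UnI2 CollectI exI[of _ "a"] exI[of _ "f b"] exI[of _ "g p"]) (auto simp: frag_extend_diff)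
      done
  qed
  from x have "x \<in> generate F (tensor_relations R M P)" by (simp add: tensor_null_def)
  then show ?thesis
  proof induction
    case one then show ?case using H_zero by (simp add: free_Abelian_group_def)
  next
    case (incl h) then show ?case by (rule rel)
  next
    case (inv h)
    have "inv\<^bsub>F\<^esub> h = - h" using inv rels_sub F_inv by blast
    then show ?case using rel[OF inv] H_minus by (simp add: frag_extend_minus)
  next
    case (eng a b) then show ?case using H_add by (simp add: free_Abelian_group_def frag_extend_add)
  qed
qed

lemma tensor_map_coset:
  assumes f: "\<And>m. m \<in> carrier M \<Longrightarrow> f m \<in> carrier M"
    "\<And>x y. x \<in> carrier M \<Longrightarrow> y \<in> carrier M \<Longrightarrow> f (x \<oplus>\<^bsub>M\<^esub> y) = f x \<oplus>\<^bsub>M\<^esub> f y"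
    "\<And>r x. r \<in> carrier R \<Longrightarrow> x \<in> carrier M \<Longrightarrow> f (r \<odot>\<^bsub>M\<^esub> x) = r \<odot>\<^bsub>M\<^esub> f x"
   and g: "\<And>m. m \<in> carrier P \<Longrightarrow> g m \<in> carrier P"
    "\<And>x y. x \<in> carrier P \<Longrightarrow> y \<in> carrier P \<Longrightarrow> g (x \<oplus>\<^bsub>P\<^esub> y) = g x \<oplus>\<^bsub>P\<^esub> g y"
    "\<And>r x. r \<in> carrier R \<Longrightarrow> x \<in> carrier P \<Longrightarrow> g (r \<odot>\<^bsub>P\<^esub> x) = r \<odot>\<^bsub>P\<^esub> g x"
  shows "tensor_map R M P f g (H #>\<^bsub>F\<^esub> x) = H #>\<^bsub>F\<^esub> frag_extend (\<lambda>(m, p). frag_of (f m, g p)) x"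
    (is "_ = _ #>\<^bsub>_\<^esub> ?e x")
proof -
  have "H #>\<^bsub>F\<^esub> ?e c = H #>\<^bsub>F\<^esub> ?e x" if "c \<in> H #>\<^bsub>F\<^esub> x" for c
  proof -
    from that obtain h where h: "h \<in> H" "c = h + x" unfolding coset_eq by auto
    show ?thesis by (rule coset_eqI) (use h hom_H[OF f g, of h] in \<open>simp add: frag_extend_add\<close>)
  qed
  moreover have "x \<in> H #>\<^bsub>F\<^esub> x" unfolding coset_eq using H_zero by force
  ultimately show ?thesis unfolding tensor_map_def by blast
qed

lemma carrier_tg: "carrier (tensor_group R M P) = {H #>\<^bsub>F\<^esub> x | x. x \<in> carrier F}"
  by (auto simp: tensor_group_def FactGroup_def RCOSETS_def)

lemma mult_tg: "x \<in> carrier F \<Longrightarrow> y \<in> carrier F \<Longrightarrow>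
    (H #>\<^bsub>F\<^esub> x) \<otimes>\<^bsub>tensor_group R M P\<^esub> (H #>\<^bsub>F\<^esub> y) = H #>\<^bsub>F\<^esub> (x + y)"
  using normal.rcos_sum[OF H_normal, of x y] 
  by (simp add: tensor_group_def FactGroup_def free_Abelian_group_def)

lemma tg_comm: "comm_group (tensor_group R M P)"
  unfolding tensor_group_def by (rule comm_group.abelian_FactGroup[OF F_comm H_subgroup])

end

lemma restrict_scalars_module:
  assumes "cring R" "cring S" "\<phi> \<in> ring_hom R S"
  shows "Module.module R (restrict_scalars S \<phi>)"
proof -
  interpret R: cring R by fact
  interpret S: cring S by fact
  note h = ring_hom_closed[OF assms(3)] ring_hom_add[OF assms(3)] ring_hom_mult[OF assms(3)] ring_hom_one[OF assms(3)]
  have ag: "abelian_group (restrict_scalars S \<phi>)"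
    by (rule abelian_groupI) (auto simp: restrict_scalars_def S.a_ac intro: S.l_neg exI[of _ "\<ominus>\<^bsub>S\<^esub> _"] bexI[of _ "\<ominus>\<^bsub>S\<^esub> _"])
  show ?thesis
    by (rule Module.moduleI[OF assms(1) ag])
      (auto simp: restrict_scalars_def h S.l_distr S.r_distr S.m_assoc)
qed

lemma base_change_module:
  assumes "Module.module R M" "cring S" "\<phi> \<in> ring_hom R S"
  shows "Module.module S (base_change R S \<phi> M)"
proof -
  interpret S: cring S by fact
  have R: "cring R" using assms(1) by (simp add: Module.module_def)
  let ?P = "restrict_scalars S \<phi>"
  interpret tensor_setting R M ?P
    using assms(1) restrict_scalars_module[OF R assms(2,3)] by (simp add: tensor_setting_def)
  note h = ring_hom_closed[OF assms(3)] ring_hom_add[OF assms(3)] ring_hom_mult[OF assms(3)] ring_hom_one[OF assms(3)]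
  interpret T: comm_group "tensor_group R M ?P" by (rule tg_comm)
  have ag: "abelian_group (base_change R S \<phi> M)"
    by (rule abelian_groupI)
       (auto simp: base_change_def T.m_ac intro: T.l_inv bexI[of _ "inv\<^bsub>tensor_group R M ?P\<^esub> _"])
  let ?e = "\<lambda>s. frag_extend (\<lambda>(m, p). frag_of (m, s \<otimes>\<^bsub>S\<^esub> p))"
  have sm: "s \<odot>\<^bsub>base_change R S \<phi> M\<^esub> (H #>\<^bsub>F\<^esub> x) = H #>\<^bsub>F\<^esub> ?e s x" if "s \<in> carrier S" for s x
    unfolding base_change_def using that
    by simp (rule tensor_map_coset, auto simp: restrict_scalars_def S.r_distr h S.m_ac)
  have ecl: "?e s x \<in> carrier F" if "s \<in> carrier S" "x \<in> carrier F" for s x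
    by (rule frag_extend_tensor_in) (use that in \<open>auto simp: restrict_scalars_def\<close>)
  have cb: "carrier (base_change R S \<phi> M) = {H #>\<^bsub>F\<^esub> x | x. x \<in> carrier F}"
    by (simp add: base_change_def carrier_tg)
  have ad: "(H #>\<^bsub>F\<^esub> x) \<oplus>\<^bsub>base_change R S \<phi> M\<^esub> (H #>\<^bsub>F\<^esub> y) = H #>\<^bsub>F\<^esub> (x + y)" 
    if "x \<in> carrier F" "y \<in> carrier F" for x y
    using mult_tg[OF that] by (simp add: base_change_def)
  have dist: "?e (a \<oplus>\<^bsub>S\<^esub> b) x - (?e a x + ?e b x) \<in> H" if ab: "a \<in> carrier S" "b \<in> carrier S" and x: "x \<in> carrier F" for a b x
  proof -
    from x have "Poly_Mapping.keys x \<subseteq> carrier M \<times> carrier S" by (simp add: free_Abelian_group_def restrict_scalars_def)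
    then show ?thesis
    proof (induction x rule: frag_induction)
      case zero then show ?case using H_zero by simp
    next
      case (one q)
      then obtain m p where q: "q = (m, p)" "m \<in> carrier M" "p \<in> carrier S" by auto
      have "frag_of (m, (a \<otimes>\<^bsub>S\<^esub> p) \<oplus>\<^bsub>?P\<^esub> (b \<otimes>\<^bsub>S\<^esub> p)) - frag_of (m, a \<otimes>\<^bsub>S\<^esub> p) - frag_of (m, b \<otimes>\<^bsub>S\<^esub> p) \<in> H"
        by (rule rel_in_H) (unfold tensor_relations_def, rule UnI1, rule UnI2, intro CollectI exI[of _ m] exI[of _ "a \<otimes>\<^bsub>S\<^esub> p"] exI[of _ "b \<otimes>\<^bsub>S\<^esub> p"], use q ab in \<open>simp add: restrict_scalars_def\<close>)
      then show ?case using q ab by (simp add: restrict_scalars_def S.l_distr algebra_simps)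
    next
      case (diff x y)
      show ?case using H_diff[OF diff] by (simp add: frag_extend_diff algebra_simps)
    qed
  qed
  have assoc: "?e (a \<otimes>\<^bsub>S\<^esub> b) x = ?e a (?e b x)" if ab: "a \<in> carrier S" "b \<in> carrier S" and x: "x \<in> carrier F" for a b x
  proof -
    from x have "Poly_Mapping.keys x \<subseteq> carrier M \<times> carrier S" by (simp add: free_Abelian_group_def restrict_scalars_def)
    then show ?thesis
      by (induction x rule: frag_induction) (use ab in \<open>auto simp: frag_extend_diff S.m_assoc\<close>)
  qed
  have unit: "?e \<one>\<^bsub>S\<^esub> x = x" if x: "x \<in> carrier F" for x
  proof -
    from x have "Poly_Mapping.keys x \<subseteq> carrier M \<times> carrier S" by (simp add: free_Abelian_group_def restrict_scalars_def)
    then show ?thesis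
      by (induction x rule: frag_induction) (auto simp: frag_extend_diff)
  qed
  show ?thesis
  proof (rule Module.moduleI[OF assms(2) ag], goal_cases)
    case (1 a x)
    then obtain y where y: "x = H #>\<^bsub>F\<^esub> y" "y \<in> carrier F" by (auto simp: cb)
    show ?case using 1(1) y ecl[OF 1(1) y(2)] unfolding cb by (auto simp: sm)
  next
    case (2 a b x)
    then obtain y where y: "x = H #>\<^bsub>F\<^esub> y" "y \<in> carrier F" by (auto simp: cb)
    show ?case unfolding y(1) using 2(1,2) coset_eqI[OF dist[OF 2(1,2) y(2)]]
      by (simp add: sm ad[OF ecl[OF 2(1) y(2)] ecl[OF 2(2) y(2)]])
  next
    case (3 a x y)
    then obtain x' y' where y: "x = H #>\<^bsub>F\<^esub> x'" "x' \<in> carrier F" "y = H #>\<^bsub>F\<^esub> y'" "y' \<in> carrier F" by (auto simp: cb)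
    show ?case unfolding y(1,3) using 3(1)
      by (simp add: sm ad[OF y(2,4)] ad[OF ecl[OF 3(1) y(2)] ecl[OF 3(1) y(4)]] frag_extend_add)
  next
    case (4 a b x)
    then obtain y where y: "x = H #>\<^bsub>F\<^esub> y" "y \<in> carrier F" by (auto simp: cb)
    show ?case using 4(1,2) y by (simp add: sm assoc)
  next
    case (5 x)
    then obtain y where y: "x = H #>\<^bsub>F\<^esub> y" "y \<in> carrier F" by (auto simp: cb)
    show ?case using y by (simp add: sm unit)
  qed
qed

corollary base_change_vectorspace:
  assumes "Module.module R M" "fraction_field R K \<iota>"
  shows "vectorspace K (base_change R K \<iota> M)"
proof -
  have K: "field K" and \<iota>: "\<iota> \<in> ring_hom R K"
    using assms(2) by (auto simp: fraction_field_def)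
  then show ?thesis
    using base_change_module[OF assms(1) field.axioms(1)[THEN domain.axioms(1)] \<iota>]
    by (simp add: vectorspace_def)
qed

lemma residue_field_facts:
  assumes "discrete_valuation_ring A"
  shows "maximalideal (max_ideal A) A" "field (residue_field A)" "residue_map A \<in> ring_hom A (residue_field A)"
proof -
  interpret discrete_valuation_ring A by fact
  show m: "maximalideal (max_ideal A) A"
    unfolding max_ideal_def using unique_maximal by (rule theI')
  then interpret maximalideal "max_ideal A" A .
  show "field (residue_field A)" unfolding residue_field_def by (rule quotient_is_field) unfold_locales
  show "residue_map A \<in> ring_hom A (residue_field A)" unfolding residue_field_def
    using rcos_ring_hom by (simp add: residue_map_def[abs_def])
qed

end

theory Submission
  imports Defs
begin

text \<open>
  Let \<open>N\<close> act on \<open>V\<close> through the twist \<open>\<sigma> n v = \<psi>(n)\<inverse> \<rho>(n) v\<close>, and let \<open>D\<close> be the submodule of \<open>V\<close>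
  spanned by the elements \<open>\<sigma> n v - v\<close> (\<open>augmentation\<close> below).  The equivariant forms on \<open>V\<close> are the
  linear forms that vanish on \<open>D\<close>, and \<open>v \<mapsto> T (v \<otimes> 1)\<close> is a linear form \<open>t\<close> from \<open>V\<close> to the residue field
  that vanishes on \<open>D\<close>.  So a linear form on \<open>V/D\<close> with values in the residue field has to be lifted
  to one with values in the ring, and this rests on two facts.

  The module \<open>V/D\<close> is torsion free (\<open>augmentation_pure\<close>).  For a compact open subgroup \<open>K\<close> and a small
  open normal subgroup \<open>U\<close> of \<open>K\<close>, let \<open>S v\<close> be the sum of the translates of \<open>v\<close> over \<open>K/U\<close>.
  The operator \<open>S\<close> kills any given element of \<open>D\<close> as soon as \<open>K\<close> is large and \<open>U\<close> is small, because \<open>K\<close>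
  then contains the finitely many group elements that occur in it.  Conversely \<open>S v\<close> is congruent to
  \<open>[K : U] v\<close> modulo \<open>D\<close>.  Hence \<open>a v \<in> D\<close> gives \<open>a (S v) = 0\<close>, thus \<open>S v = 0\<close>, thus \<open>[K : U] v \<in> D\<close>,
  and \<open>[K : U]\<close> is a unit.

  Over a complete discrete valuation ring with uniformizer \<open>p\<close>, every linear form from a torsion-free
  module to the residue field lifts (\<open>residual_form_lifts\<close>).  A lift that is defined on a submodule
  which is pure, that is, closed under division by \<open>p\<close>, extends to one more element \<open>z\<close> if \<open>z\<close> is
  nonzero modulo \<open>p\<close> and the submodule: the sum with the span of \<open>z\<close> is then direct and pure, and any
  lift of \<open>t z\<close> may be taken as the value at \<open>z\<close>.  By Zorn's lemma there is a lift on a pure submodule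
  that is \<open>p\<close>-adically dense in the module, and it extends to the whole module by continuity, since the
  ring is complete.
\<close>

section \<open>Discrete valuation rings\<close>

lemma (in cring) ideals_set_pow_cgenideal:
  assumes a: "a \<in> carrier R"
  shows "PIdl a [^]\<^bsub>ideals_set R\<^esub> (n::nat) = PIdl (a [^] n)"
proof (induction n)
  case 0
  show ?case
    by (force simp: ideals_set_def nat_pow_def cgenideal_def)
next
  case (Suc n)
  have "PIdl a [^]\<^bsub>ideals_set R\<^esub> Suc n = ideal_prod R (PIdl (a [^] n)) (PIdl a)"
    using Suc by (simp add: ideals_set_def nat_pow_def)
  also have "\<dots> = Idl (PIdl (a [^] n \<otimes> a))"
    using a by (simp add: ideal_prod_eq_genideal cgenideal_ideal cgenideal_prod)
  also have "\<dots> = PIdl (a [^] Suc n)"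
  proof (rule subset_antisym)
    have I: "ideal (PIdl (a [^] n \<otimes> a)) R" using a by (simp add: cgenideal_ideal)
    show "Idl (PIdl (a [^] n \<otimes> a)) \<subseteq> PIdl (a [^] Suc n)"
      using genideal_minimal[OF I] by simp
    show "PIdl (a [^] Suc n) \<subseteq> Idl (PIdl (a [^] n \<otimes> a))"
      using genideal_self[of "PIdl (a [^] n \<otimes> a)"] ideal.Icarr[OF I] by auto
  qed
  finally show ?case .
qed

context discrete_valuation_ring
begin

lemma maximalideal_max_ideal: "maximalideal (max_ideal R) R"
  by (rule residue_field_facts(1)) unfold_locales

lemma uniformizer_exists: "\<exists>p\<in>carrier R. max_ideal R = PIdl p \<and> p \<noteq> \<zero>"
proof -
  interpret m: maximalideal "max_ideal R" R by (rule maximalideal_max_ideal)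
  obtain p where p: "p \<in> carrier R" "max_ideal R = PIdl p"
    using exists_gen[OF m.is_ideal] by blast
  moreover have "p \<noteq> \<zero>"
  proof
    assume "p = \<zero>"
    then have "max_ideal R = {\<zero>}" using p cgenideal_eq_genideal[of p] genideal_zero by simp
    then show False
      using maximalideal_max_ideal zeromaximalideal_fieldI not_field by metis
  qed
  ultimately show ?thesis by blast
qed

text \<open>A nonzero nonunit has an irreducible divisor, and this generates the only maximal ideal there is.\<close>

lemma nonunit_in_max_ideal:
  assumes "a \<in> carrier R" "a \<notin> Units R"
  shows "a \<in> max_ideal R"
proof (cases "a = \<zero>")
  case True
  interpret m: maximalideal "max_ideal R" R by (rule maximalideal_max_ideal)
  show ?thesis using True by simp
next
  case False
  then obtain q where q: "q \<in> carrier R" "ring_irreducible q" "q divides a"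
    using exists_irreducible_divisor assms by blast
  then have "maximalideal (PIdl q) R" by (simp add: irreducible_imp_maximalideal)
  then have "PIdl q = max_ideal R"
    using unique_maximal maximalideal_max_ideal by blast
  then show ?thesis
    using q assms(1) by (auto simp: factor_def cgenideal_def m_comm)
qed

text \<open>The quotients \<open>c n\<close> of \<open>x\<close> by \<open>p ^ n\<close> generate an increasing chain of ideals.  It becomes
  stationary, and then \<open>c (n + 1)\<close> is a multiple of \<open>c n = p c (n + 1)\<close>, so \<open>p\<close> would be a unit if \<open>x\<close> were
  nonzero.\<close>

lemma infinitely_divisible_imp_zero:
  assumes p: "p \<in> carrier R" "max_ideal R = PIdl p" and x: "x \<in> carrier R"
    and div: "\<And>n::nat. \<exists>c\<in>carrier R. x = p [^] n \<otimes> c"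
  shows "x = \<zero>"
proof (rule ccontr)
  assume x0: "x \<noteq> \<zero>"
  interpret m: maximalideal "max_ideal R" R by (rule maximalideal_max_ideal)
  obtain c where c: "\<And>n::nat. c n \<in> carrier R" "\<And>n. x = p [^] n \<otimes> c n"
    using div by metis
  have p0: "p [^] n \<noteq> \<zero>" for n :: nat
    using c(2)[of n] c(1)[of n] x0 by (metis l_null)
  have c_step: "c n = p \<otimes> c (Suc n)" for n
  proof -
    have "p [^] n \<otimes> c n = p [^] n \<otimes> (p \<otimes> c (Suc n))"
      using c(1)[of "Suc n"] c(2)[of n] c(2)[of "Suc n"] p by (simp add: m_assoc)
    then show ?thesis using m_lcancel[of "p [^] n" "c n"] p0[of n] p c(1) by simp
  qed
  define C where "C = range (\<lambda>n. PIdl (c n))"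
  have mono: "PIdl (c n) \<subseteq> PIdl (c m)" if "n \<le> m" for n m
    using that
  proof (induction m rule: dec_induct)
    case (step k)
    have "PIdl (c k) \<subseteq> PIdl (c (Suc k))"
    proof (rule cgenideal_minimal)
      show "ideal (PIdl (c (Suc k))) R" using c(1) by (simp add: cgenideal_ideal)
      show "c k \<in> PIdl (c (Suc k))"
        unfolding cgenideal_def using c_step[of k] p by blast
    qed
    then show ?case using step by blast
  qed simp
  have "subset.chain {I. ideal I R} C"
  proof -
    have "PIdl (c n) \<subseteq> PIdl (c m) \<or> PIdl (c m) \<subseteq> PIdl (c n)" for n m
      using mono nle_le by metis
    then show ?thesis
      unfolding pred_on.chain_def C_def using cgenideal_ideal[OF c(1)] by blast
  qed
  then have "\<Union>C \<in> C" by (intro ideal_chain_is_trivial) (auto simp: C_def)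
  then obtain n where n: "\<Union>C = PIdl (c n)" by (auto simp: C_def)
  have "c (Suc n) \<in> PIdl (c n)"
    using cgenideal_self[OF c(1)] n[symmetric] by (auto simp: C_def)
  then obtain r where r: "r \<in> carrier R" "c (Suc n) = r \<otimes> c n" by (auto simp: cgenideal_def)
  have cn: "c (Suc n) \<noteq> \<zero>" using c(2)[of "Suc n"] x0 p by auto
  have "\<one> \<otimes> c (Suc n) = (r \<otimes> p) \<otimes> c (Suc n)"
    using r c_step[of n] c(1) p by (simp add: m_assoc)
  then have "\<one> = r \<otimes> p"
    using cn m_rcancel c(1) r p by (metis m_closed one_closed)
  moreover have "r \<otimes> p \<in> max_ideal R" using p(2) r(1) unfolding cgenideal_def by blast
  ultimately have "\<one> \<in> max_ideal R" by metis
  then show False using m.one_imp_carrier m.I_notcarr by simp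
qed
end

text \<open>Completeness for a sequence whose rate of convergence is known, in terms of powers of a uniformizer
  instead of powers of the maximal ideal; the limit is approached at the same rate.\<close>

lemma (in complete_discrete_valuation_ring) adic_limit:
  assumes p: "p \<in> carrier R" "max_ideal R = PIdl p"
    and x: "\<And>n::nat. x n \<in> carrier R"
    and cauchy: "\<And>n i. n \<le> i \<Longrightarrow> \<exists>c\<in>carrier R. x i \<ominus> x n = p [^] n \<otimes> c"
  shows "\<exists>l\<in>carrier R. \<forall>n. \<exists>c\<in>carrier R. x n \<ominus> l = p [^] n \<otimes> c"
proof -
  have pow: "max_ideal R [^]\<^bsub>ideals_set R\<^esub> n = PIdl (p [^] n)" for n :: nat
    using p by (simp add: ideals_set_pow_cgenideal)
  have mem: "y \<in> PIdl (p [^] n) \<longleftrightarrow> (\<exists>c\<in>carrier R. y = p [^] n \<otimes> c)" for y and n :: nat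
    using m_comm nat_pow_closed[OF p(1), of n] unfolding cgenideal_def mem_Collect_eq by metis
  have idl: "ideal (PIdl (p [^] n)) R" for n :: nat
    using p by (simp add: cgenideal_ideal)
  have diff: "a \<ominus> c \<in> PIdl (p [^] n)" if "a \<ominus> b \<in> PIdl (p [^] n)" "b \<ominus> c \<in> PIdl (p [^] n)"
    "a \<in> carrier R" "b \<in> carrier R" "c \<in> carrier R" for a b c and n :: nat
  proof -
    interpret ideal "PIdl (p [^] n)" R by (rule idl)
    have "a \<ominus> c = (a \<ominus> b) \<oplus> (b \<ominus> c)" using that(3-) by algebra
    then show ?thesis using that by simp
  qed
  have sym: "a \<ominus> b \<in> PIdl (p [^] n)" if "b \<ominus> a \<in> PIdl (p [^] n)"
    "a \<in> carrier R" "b \<in> carrier R" for a b and n :: nat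
  proof -
    interpret ideal "PIdl (p [^] n)" R by (rule idl)
    have "a \<ominus> b = \<ominus> (b \<ominus> a)" using that(2-) by algebra
    then show ?thesis using that by simp
  qed
  have ca: "x i \<ominus> x n \<in> PIdl (p [^] n)" if "n \<le> i" for n i
    using cauchy[OF that] by (simp add: mem)
  have "\<exists>l\<in>carrier R. \<forall>n :: nat. \<exists>M. \<forall>i\<ge>M. x i \<ominus> l \<in> max_ideal R [^]\<^bsub>ideals_set R\<^esub> n"
  proof (rule complete[OF x])
    fix n :: nat
    show "\<exists>M. \<forall>i\<ge>M. \<forall>j\<ge>M. x i \<ominus> x j \<in> max_ideal R [^]\<^bsub>ideals_set R\<^esub> n"
      unfolding pow
      by (rule exI[of _ n], intro allI impI, rule diff[of _ "x n"]) (simp_all add: ca sym x)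
  qed
  then obtain l where l: "l \<in> carrier R" "\<And>n::nat. \<exists>M. \<forall>i\<ge>M. x i \<ominus> l \<in> PIdl (p [^] n)"
    unfolding pow by blast
  have "x n \<ominus> l \<in> PIdl (p [^] n)" for n
  proof -
    obtain M where M: "\<And>i. i \<ge> M \<Longrightarrow> x i \<ominus> l \<in> PIdl (p [^] n)" using l(2) by blast
    show ?thesis
      using diff[OF sym[OF ca[of n "max n M"]] M[of "max n M"]] x l(1) by simp
  qed
  then show ?thesis using l(1) by (auto simp: mem)
qed

section \<open>Lifting linear forms from the residue field\<close>

text \<open>The form \<open>t\<close> is to be lifted to a form on \<open>M/W\<close> with values in \<open>R\<close>.  Division by the uniformizer
  \<open>p\<close> suffices to express that \<open>M/W\<close> is torsion free, as every nonzero element of \<open>R\<close> is a unit times a power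
  of \<open>p\<close>.\<close>

locale lifting_problem = complete_discrete_valuation_ring R + M?: Module.module R M
  for R (structure) and M +
  fixes p and W and t
  assumes p_closed: "p \<in> carrier R"
    and max_ideal_eq: "max_ideal R = PIdl p"
    and W: "Module.submodule W R M"
    and W_pure: "\<And>v. v \<in> carrier M \<Longrightarrow> p \<odot>\<^bsub>M\<^esub> v \<in> W \<Longrightarrow> v \<in> W"
    and t: "t \<in> module_hom R M (restrict_scalars (residue_field R) (residue_map R))"
    and t_W: "\<And>w. w \<in> W \<Longrightarrow> t w = \<zero>\<^bsub>residue_field R\<^esub>"
begin

text \<open>Partial lifts are encoded by their graphs, so that extension is inclusion and the union of a chain
  is again a partial lift.  The condition on \<open>(0, a)\<close> makes the relation a function, and the last one says that
  its domain is pure.\<close>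

definition partial_lift :: "('c \<times> 'a) set \<Rightarrow> bool" where
  "partial_lift G \<longleftrightarrow>
     G \<subseteq> carrier M \<times> carrier R \<and>
     (\<forall>w\<in>W. (w, \<zero>) \<in> G) \<and>
     (\<forall>v a w b. (v, a) \<in> G \<longrightarrow> (w, b) \<in> G \<longrightarrow> (v \<oplus>\<^bsub>M\<^esub> w, a \<oplus> b) \<in> G) \<and>
     (\<forall>c v a. c \<in> carrier R \<longrightarrow> (v, a) \<in> G \<longrightarrow> (c \<odot>\<^bsub>M\<^esub> v, c \<otimes> a) \<in> G) \<and>
     (\<forall>a. (\<zero>\<^bsub>M\<^esub>, a) \<in> G \<longrightarrow> a = \<zero>) \<and>
     (\<forall>v a. (v, a) \<in> G \<longrightarrow> t v = residue_map R a) \<and>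
     (\<forall>v a. v \<in> carrier M \<longrightarrow> (p \<odot>\<^bsub>M\<^esub> v, a) \<in> G \<longrightarrow> (\<exists>b. (v, b) \<in> G))"

lemma partial_liftD:
  assumes "partial_lift G"
  shows "(v, a) \<in> G \<Longrightarrow> v \<in> carrier M" "(v, a) \<in> G \<Longrightarrow> a \<in> carrier R"
    "w \<in> W \<Longrightarrow> (w, \<zero>) \<in> G"
    "(v, a) \<in> G \<Longrightarrow> (w, b) \<in> G \<Longrightarrow> (v \<oplus>\<^bsub>M\<^esub> w, a \<oplus> b) \<in> G"
    "c \<in> carrier R \<Longrightarrow> (v, a) \<in> G \<Longrightarrow> (c \<odot>\<^bsub>M\<^esub> v, c \<otimes> a) \<in> G"
    "(\<zero>\<^bsub>M\<^esub>, a) \<in> G \<Longrightarrow> a = \<zero>"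
    "(v, a) \<in> G \<Longrightarrow> t v = residue_map R a"
    "v \<in> carrier M \<Longrightarrow> (p \<odot>\<^bsub>M\<^esub> v, a) \<in> G \<Longrightarrow> \<exists>b. (v, b) \<in> G"
proof -
  note D = assms[unfolded partial_lift_def]
  note D1 = D[THEN conjunct1] and D' = D[THEN conjunct2]
  note D2 = D'[THEN conjunct1] and D' = D'[THEN conjunct2]
  note D3 = D'[THEN conjunct1] and D' = D'[THEN conjunct2]
  note D4 = D'[THEN conjunct1] and D' = D'[THEN conjunct2]
  note D5 = D'[THEN conjunct1] and D' = D'[THEN conjunct2]
  note D6 = D'[THEN conjunct1] and D7 = D'[THEN conjunct2]
  show "(v, a) \<in> G \<Longrightarrow> v \<in> carrier M" "(v, a) \<in> G \<Longrightarrow> a \<in> carrier R"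
    using D1 by blast+
  show "w \<in> W \<Longrightarrow> (w, \<zero>) \<in> G" using D2 by blast
  show "(v, a) \<in> G \<Longrightarrow> (w, b) \<in> G \<Longrightarrow> (v \<oplus>\<^bsub>M\<^esub> w, a \<oplus> b) \<in> G" using D3 by blast
  show "c \<in> carrier R \<Longrightarrow> (v, a) \<in> G \<Longrightarrow> (c \<odot>\<^bsub>M\<^esub> v, c \<otimes> a) \<in> G" using D4 by blast
  show "(\<zero>\<^bsub>M\<^esub>, a) \<in> G \<Longrightarrow> a = \<zero>" using D5 by blast
  show "(v, a) \<in> G \<Longrightarrow> t v = residue_map R a" using D6 by simp
  show "v \<in> carrier M \<Longrightarrow> (p \<odot>\<^bsub>M\<^esub> v, a) \<in> G \<Longrightarrow> \<exists>b. (v, b) \<in> G" using D7 by blast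
qed

lemma residue_hom: "residue_map R \<in> ring_hom R (residue_field R)"
  by (rule residue_field_facts(3)) unfold_locales

lemma residue_field_field: "field (residue_field R)"
  by (rule residue_field_facts(2)) unfold_locales

lemma residue_eqI:
  assumes "a \<in> carrier R" "b \<in> carrier R" "c \<in> carrier R" "a \<ominus> b = p \<otimes> c"
  shows "residue_map R a = residue_map R b"
proof -
  interpret m: maximalideal "max_ideal R" R by (rule maximalideal_max_ideal)
  have "p \<otimes> c \<in> max_ideal R"
    using assms(3) p_closed m_comm[of p c] unfolding max_ideal_eq cgenideal_def by blast
  then show ?thesis
    using quotient_eq_iff_same_a_r_cos[OF m.is_ideal assms(1,2)] assms(4)
    unfolding residue_map_def by simp
qed

lemma residue_surj: "x \<in> carrier (residue_field R) \<Longrightarrow> \<exists>s\<in>carrier R. x = residue_map R s"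
  by (auto simp: residue_field_def residue_map_def FactRing_def A_RCOSETS_def')

lemma t_closed: "v \<in> carrier M \<Longrightarrow> t v \<in> carrier (residue_field R)"
  using module_hom_closed[OF t] by (auto simp: restrict_scalars_def)

lemma t_add: "v \<in> carrier M \<Longrightarrow> w \<in> carrier M \<Longrightarrow> t (v \<oplus>\<^bsub>M\<^esub> w) = t v \<oplus>\<^bsub>residue_field R\<^esub> t w"
  using module_hom_add[OF t] by (auto simp: restrict_scalars_def)

lemma t_smult: "c \<in> carrier R \<Longrightarrow> v \<in> carrier M \<Longrightarrow>
    t (c \<odot>\<^bsub>M\<^esub> v) = residue_map R c \<otimes>\<^bsub>residue_field R\<^esub> t v"
  using module_hom_smult[OF t] by (auto simp: restrict_scalars_def)

lemma residue_p: "residue_map R p = \<zero>\<^bsub>residue_field R\<^esub>"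
proof -
  interpret k: field "residue_field R" by (rule residue_field_field)
  have "residue_map R p = residue_map R \<zero>"
    by (rule residue_eqI[of _ _ \<one>]) (use p_closed in \<open>auto simp: a_minus_def\<close>)
  also have "\<dots> = \<zero>\<^bsub>residue_field R\<^esub>"
    using ring_hom_zero[OF residue_hom] ring_axioms k.ring_axioms by blast
  finally show ?thesis .
qed

lemma t_add_p_smult:
  assumes "v \<in> carrier M" "u \<in> carrier M"
  shows "t (v \<oplus>\<^bsub>M\<^esub> p \<odot>\<^bsub>M\<^esub> u) = t v"
proof -
  interpret k: field "residue_field R" by (rule residue_field_field)
  show ?thesis using assms p_closed by (simp add: t_add t_smult residue_p t_closed)
qed

lemma partial_lift_minus:
  assumes G: "partial_lift G" and "(v, a) \<in> G" "(w, b) \<in> G"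
  shows "(v \<ominus>\<^bsub>M\<^esub> w, a \<ominus> b) \<in> G"
proof -
  note c = partial_liftD(1,2)[OF G]
  have "(v \<oplus>\<^bsub>M\<^esub> (\<ominus> \<one>) \<odot>\<^bsub>M\<^esub> w, a \<oplus> (\<ominus> \<one>) \<otimes> b) \<in> G"
    using assms by (intro partial_liftD(4,5)[OF G]) auto
  then show ?thesis
    using c[OF assms(2)] c[OF assms(3)]
    by (simp add: M.smult_l_minus a_minus_def l_minus)
qed

lemma partial_lift_unique:
  assumes G: "partial_lift G" and "(v, a) \<in> G" "(v, b) \<in> G"
  shows "a = b"
proof -
  note c = partial_liftD(1,2)[OF G]
  have "a \<ominus> b = \<zero>"
    using partial_lift_minus[OF assms] partial_liftD(6)[OF G] c[OF assms(2)]
    by (simp add: M.minus_eq M.r_neg)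
  then show ?thesis using c assms by simp
qed

lemma partial_lift_pow:
  assumes G: "partial_lift G" and v: "v \<in> carrier M" and "(p [^] (n::nat) \<odot>\<^bsub>M\<^esub> v, a) \<in> G"
  shows "\<exists>b. (v, b) \<in> G \<and> a = p [^] n \<otimes> b"
proof -
  have "\<exists>b. (v, b) \<in> G"
    using assms(3)
  proof (induction n arbitrary: a)
    case 0
    then show ?case using v by auto
  next
    case (Suc n)
    have "p [^] Suc n \<odot>\<^bsub>M\<^esub> v = p \<odot>\<^bsub>M\<^esub> (p [^] n \<odot>\<^bsub>M\<^esub> v)"
      using v p_closed by (simp add: M.smult_assoc1[symmetric] m_comm)
    then obtain b where "(p [^] n \<odot>\<^bsub>M\<^esub> v, b) \<in> G"
      using partial_liftD(8)[OF G] Suc.prems v p_closed by (metis M.smult_closed nat_pow_closed)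
    then show ?case by (rule Suc.IH)
  qed
  then obtain b where b: "(v, b) \<in> G" ..
  have "a = p [^] n \<otimes> b"
    by (rule partial_lift_unique[OF G assms(3)]) (use partial_liftD(5)[OF G _ b] p_closed in auto)
  with b show ?thesis by blast
qed

lemma partial_lift_start: "partial_lift (W \<times> {\<zero>})"
proof -
  interpret k: field "residue_field R" by (rule residue_field_field)
  note W' = M.submoduleE[OF W]
  have "residue_map R \<zero> = \<zero>\<^bsub>residue_field R\<^esub>"
    using ring_hom_zero[OF residue_hom] ring_axioms k.ring_axioms by blast
  then show ?thesis
    unfolding partial_lift_def using W' W_pure t_W by auto
qed

lemma partial_lift_Union:
  assumes "C \<noteq> {}" and chain: "subset.chain {G. partial_lift G} C"
  shows "partial_lift (\<Union>C)"
proof -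
  have G: "partial_lift G" if "G \<in> C" for G
    using chain that by (auto simp: pred_on.chain_def)
  have two: "\<exists>G\<in>C. x \<in> G \<and> y \<in> G" if xy: "x \<in> \<Union>C" "y \<in> \<Union>C" for x y
  proof -
    obtain D E where "D \<in> C" "E \<in> C" "x \<in> D" "y \<in> E" using xy by blast
    moreover from this have "D \<subseteq> E \<or> E \<subseteq> D" using chain by (auto simp: pred_on.chain_def)
    ultimately show ?thesis by blast
  qed
  show ?thesis
    unfolding partial_lift_def
  proof (intro conjI allI impI ballI subsetI)
    fix x assume "x \<in> \<Union>C"
    then show "x \<in> carrier M \<times> carrier R" using partial_liftD(1,2)[OF G] by (cases x) blast
  next
    fix w assume "w \<in> W"
    then show "(w, \<zero>) \<in> \<Union>C" using assms(1) partial_liftD(3)[OF G] by blast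
  next
    fix v a w b assume "(v, a) \<in> \<Union>C" "(w, b) \<in> \<Union>C"
    then obtain D where "D \<in> C" "(v, a) \<in> D" "(w, b) \<in> D" using two by blast
    then show "(v \<oplus>\<^bsub>M\<^esub> w, a \<oplus> b) \<in> \<Union>C" using partial_liftD(4)[OF G] by blast
  next
    fix c v a assume "c \<in> carrier R" "(v, a) \<in> \<Union>C"
    then show "(c \<odot>\<^bsub>M\<^esub> v, c \<otimes> a) \<in> \<Union>C" using partial_liftD(5)[OF G] by blast
  next
    fix a assume "(\<zero>\<^bsub>M\<^esub>, a) \<in> \<Union>C"
    then show "a = \<zero>" using partial_liftD(6)[OF G] by blast
  next
    fix v a assume "(v, a) \<in> \<Union>C"
    then show "t v = residue_map R a" using partial_liftD(7)[OF G] by blast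
  next
    fix v a assume "v \<in> carrier M" "(p \<odot>\<^bsub>M\<^esub> v, a) \<in> \<Union>C"
    then show "\<exists>b. (v, b) \<in> \<Union>C" using partial_liftD(8)[OF G] by blast
  qed
qed

text \<open>The element \<open>z\<close> is adjoined with an arbitrary lift \<open>s\<close> of \<open>t z\<close> as its value.  What needs an argument
  is that the sum of the domain with the span of \<open>z\<close> is direct and pure; both follow from \<open>coeff\<close>.\<close>

lemma partial_lift_extend:
  assumes G: "partial_lift G" and z: "z \<in> carrier M"
    and new: "\<And>w a u. (w, a) \<in> G \<Longrightarrow> u \<in> carrier M \<Longrightarrow> z \<noteq> w \<oplus>\<^bsub>M\<^esub> p \<odot>\<^bsub>M\<^esub> u"
  shows "\<exists>G'. partial_lift G' \<and> G \<subset> G'"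
proof -
  note c = partial_liftD(1,2)[OF G]
  note h = ring_hom_closed[OF residue_hom] ring_hom_add[OF residue_hom] ring_hom_mult[OF residue_hom]
  have W0: "\<zero>\<^bsub>M\<^esub> \<in> W"
    using subgroup.one_closed[OF Module.submodule.axioms(1)[OF W]] by simp
  have G0: "(\<zero>\<^bsub>M\<^esub>, \<zero>) \<in> G" by (rule partial_liftD(3)[OF G W0])
  obtain s where s: "s \<in> carrier R" "t z = residue_map R s"
    using residue_surj t_closed[OF z] by blast
  \<comment> \<open>If \<open>w + e z\<close> is divisible by \<open>p\<close>, then \<open>e\<close> cannot be a unit by the choice of \<open>z\<close>, so
    \<open>e = p d\<close>; now \<open>w\<close> is divisible by \<open>p\<close> too, and purity of the old domain gives \<open>v - d z\<close>.\<close>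
  have coeff: "\<exists>d b. d \<in> carrier R \<and> e = p \<otimes> d \<and> (v \<ominus>\<^bsub>M\<^esub> d \<odot>\<^bsub>M\<^esub> z, b) \<in> G"
    if e: "e \<in> carrier R" and wa: "(w, a) \<in> G" and v: "v \<in> carrier M"
      and eq: "w \<oplus>\<^bsub>M\<^esub> e \<odot>\<^bsub>M\<^esub> z = p \<odot>\<^bsub>M\<^esub> v" for e w a v
  proof -
    have w: "w \<in> carrier M" using c wa by blast
    have "e \<notin> Units R"
    proof
      assume u: "e \<in> Units R"
      then have i: "inv e \<in> carrier R" "inv e \<otimes> e = \<one>" by auto
      have "z = inv e \<odot>\<^bsub>M\<^esub> (e \<odot>\<^bsub>M\<^esub> z)"
        using i e z by (simp add: M.smult_assoc1[symmetric])
      also have "e \<odot>\<^bsub>M\<^esub> z = p \<odot>\<^bsub>M\<^esub> v \<ominus>\<^bsub>M\<^esub> w"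
        unfolding eq[symmetric] using w e z
        by (simp add: M.minus_eq M.a_ac M.r_neg2)
      also have "inv e \<odot>\<^bsub>M\<^esub> (p \<odot>\<^bsub>M\<^esub> v \<ominus>\<^bsub>M\<^esub> w)
          = (\<ominus> (inv e)) \<odot>\<^bsub>M\<^esub> w \<oplus>\<^bsub>M\<^esub> p \<odot>\<^bsub>M\<^esub> (inv e \<odot>\<^bsub>M\<^esub> v)"
        using w v i p_closed
        by (simp add: M.minus_eq M.smult_r_distr M.smult_r_minus M.smult_l_minus M.a_comm
            M.smult_assoc1[symmetric] m_comm)
      finally show False
        using new[OF partial_liftD(5)[OF G _ wa, of "\<ominus> (inv e)"], of "inv e \<odot>\<^bsub>M\<^esub> v"] i v by auto
    qed
    then have "e \<in> PIdl p" using nonunit_in_max_ideal[OF e] max_ideal_eq by simp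
    then obtain d where "d \<in> carrier R" "e = d \<otimes> p" unfolding cgenideal_def by blast
    then have d: "d \<in> carrier R" "e = p \<otimes> d" using m_comm p_closed by simp_all
    have "w = p \<odot>\<^bsub>M\<^esub> v \<ominus>\<^bsub>M\<^esub> e \<odot>\<^bsub>M\<^esub> z"
      unfolding eq[symmetric] using w e z by (simp add: M.minus_eq M.a_assoc M.r_neg)
    also have "\<dots> = p \<odot>\<^bsub>M\<^esub> (v \<ominus>\<^bsub>M\<^esub> d \<odot>\<^bsub>M\<^esub> z)"
      using d v z p_closed by (simp add: M.minus_eq M.smult_r_distr M.smult_r_minus M.smult_assoc1)
    finally have "(p \<odot>\<^bsub>M\<^esub> (v \<ominus>\<^bsub>M\<^esub> d \<odot>\<^bsub>M\<^esub> z), a) \<in> G" using wa by simp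
    moreover have "v \<ominus>\<^bsub>M\<^esub> d \<odot>\<^bsub>M\<^esub> z \<in> carrier M" using d(1) v z by simp
    ultimately obtain b where "(v \<ominus>\<^bsub>M\<^esub> d \<odot>\<^bsub>M\<^esub> z, b) \<in> G" using partial_liftD(8)[OF G] by blast
    then show ?thesis using d by metis
  qed
  define G' where "G' = {(w \<oplus>\<^bsub>M\<^esub> e \<odot>\<^bsub>M\<^esub> z, a \<oplus> e \<otimes> s) | w a e. (w, a) \<in> G \<and> e \<in> carrier R}"
  have G'I: "(w \<oplus>\<^bsub>M\<^esub> e \<odot>\<^bsub>M\<^esub> z, a \<oplus> e \<otimes> s) \<in> G'" if "(w, a) \<in> G" "e \<in> carrier R" for w a e
    using that unfolding G'_def by blast
  have sub: "G \<subseteq> G'"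
  proof
    fix x assume x: "x \<in> G"
    obtain w a where wa: "x = (w, a)" by (cases x)
    show "x \<in> G'"
      using G'I[of w a \<zero>] x c[of w a] s z unfolding wa by simp
  qed
  have "partial_lift G'"
    unfolding partial_lift_def
  proof (intro conjI allI impI ballI subsetI)
    fix x assume "x \<in> G'"
    then show "x \<in> carrier M \<times> carrier R" unfolding G'_def using c s z by blast
  next
    fix w assume "w \<in> W"
    then show "(w, \<zero>) \<in> G'" using sub partial_liftD(3)[OF G] by blast
  next
    fix v a w b assume "(v, a) \<in> G'" "(w, b) \<in> G'"
    then obtain v' a' e w' b' f where 1: "(v', a') \<in> G" "e \<in> carrier R" "(w', b') \<in> G" "f \<in> carrier R"
      "v = v' \<oplus>\<^bsub>M\<^esub> e \<odot>\<^bsub>M\<^esub> z" "a = a' \<oplus> e \<otimes> s" "w = w' \<oplus>\<^bsub>M\<^esub> f \<odot>\<^bsub>M\<^esub> z" "b = b' \<oplus> f \<otimes> s"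
      unfolding G'_def by blast
    note cc = c[OF 1(1)] c[OF 1(3)]
    have 2: "v \<oplus>\<^bsub>M\<^esub> w = (v' \<oplus>\<^bsub>M\<^esub> w') \<oplus>\<^bsub>M\<^esub> (e \<oplus> f) \<odot>\<^bsub>M\<^esub> z"
      using 1(2,4) cc z unfolding 1 by (simp add: M.smult_l_distr M.a_ac)
    have 3: "a \<oplus> b = (a' \<oplus> b') \<oplus> (e \<oplus> f) \<otimes> s"
      using 1(2,4) cc s(1) unfolding 1(6,8) by algebra
    show "(v \<oplus>\<^bsub>M\<^esub> w, a \<oplus> b) \<in> G'"
      unfolding 2 3 using 1(1-4) by (intro G'I partial_liftD(4)[OF G]) auto
  next
    fix d v a assume d: "d \<in> carrier R" and "(v, a) \<in> G'"
    then obtain v' a' e where 1: "(v', a') \<in> G" "e \<in> carrier R"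
      "v = v' \<oplus>\<^bsub>M\<^esub> e \<odot>\<^bsub>M\<^esub> z" "a = a' \<oplus> e \<otimes> s"
      unfolding G'_def by blast
    have "d \<odot>\<^bsub>M\<^esub> v = d \<odot>\<^bsub>M\<^esub> v' \<oplus>\<^bsub>M\<^esub> (d \<otimes> e) \<odot>\<^bsub>M\<^esub> z" "d \<otimes> a = d \<otimes> a' \<oplus> (d \<otimes> e) \<otimes> s"
      using 1(2) c[OF 1(1)] d s z unfolding 1 by (simp_all add: M.smult_r_distr M.smult_assoc1 r_distr m_assoc)
    then show "(d \<odot>\<^bsub>M\<^esub> v, d \<otimes> a) \<in> G'"
      using G'I[OF partial_liftD(5)[OF G d 1(1)], of "d \<otimes> e"] d 1(2) by simp
  next
    fix x assume "(\<zero>\<^bsub>M\<^esub>, x) \<in> G'"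
    then obtain w a e where 1: "(w, a) \<in> G" "e \<in> carrier R"
      "\<zero>\<^bsub>M\<^esub> = w \<oplus>\<^bsub>M\<^esub> e \<odot>\<^bsub>M\<^esub> z" "x = a \<oplus> e \<otimes> s"
      unfolding G'_def by blast
    \<comment> \<open>The sum is direct: a relation \<open>w + e z = 0\<close> may be divided by \<open>p\<close> again and again, so \<open>e\<close> is
    divisible by every power of \<open>p\<close>.\<close>
    have "\<exists>d\<in>carrier R. e = p [^] n \<otimes> d \<and> (\<exists>w b. (w, b) \<in> G \<and> w \<oplus>\<^bsub>M\<^esub> d \<odot>\<^bsub>M\<^esub> z = \<zero>\<^bsub>M\<^esub>)" for n :: nat
    proof (induction n)
      case 0
      show ?case using 1 by (intro bexI[of _ e]) auto
    next
      case (Suc n)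
      then obtain d w' b where d: "d \<in> carrier R" "e = p [^] n \<otimes> d" "(w', b) \<in> G"
        "w' \<oplus>\<^bsub>M\<^esub> d \<odot>\<^bsub>M\<^esub> z = \<zero>\<^bsub>M\<^esub>" by blast
      then have "w' \<oplus>\<^bsub>M\<^esub> d \<odot>\<^bsub>M\<^esub> z = p \<odot>\<^bsub>M\<^esub> \<zero>\<^bsub>M\<^esub>" using p_closed by simp
      from coeff[OF d(1,3) M.zero_closed this]
      obtain d' b' where d': "d' \<in> carrier R" "d = p \<otimes> d'" "(\<zero>\<^bsub>M\<^esub> \<ominus>\<^bsub>M\<^esub> d' \<odot>\<^bsub>M\<^esub> z, b') \<in> G" by blast
      show ?case
      proof (intro bexI[of _ d'] conjI exI)
        show "e = p [^] Suc n \<otimes> d'" using d(2) d' p_closed by (simp add: m_assoc)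
        show "(\<zero>\<^bsub>M\<^esub> \<ominus>\<^bsub>M\<^esub> d' \<odot>\<^bsub>M\<^esub> z, b') \<in> G" by (rule d'(3))
        show "\<zero>\<^bsub>M\<^esub> \<ominus>\<^bsub>M\<^esub> d' \<odot>\<^bsub>M\<^esub> z \<oplus>\<^bsub>M\<^esub> d' \<odot>\<^bsub>M\<^esub> z = \<zero>\<^bsub>M\<^esub>"
          using d'(1) z by (simp add: M.minus_eq M.l_neg)
      qed (rule d'(1))
    qed
    then have "e = \<zero>"
      using infinitely_divisible_imp_zero[OF p_closed max_ideal_eq 1(2)] by blast
    have "w = \<zero>\<^bsub>M\<^esub>" using 1(3)[symmetric] c[OF 1(1)] z unfolding \<open>e = \<zero>\<close> by simp
    then have "a = \<zero>" using partial_liftD(6)[OF G] 1(1) by simp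
    then show "x = \<zero>" unfolding 1(4) \<open>e = \<zero>\<close> using s(1) by simp
  next
    fix v x assume "(v, x) \<in> G'"
    then obtain w a e where 1: "(w, a) \<in> G" "e \<in> carrier R"
      "v = w \<oplus>\<^bsub>M\<^esub> e \<odot>\<^bsub>M\<^esub> z" "x = a \<oplus> e \<otimes> s"
      unfolding G'_def by blast
    then show "t v = residue_map R x"
      using c[OF 1(1)] z s partial_liftD(7)[OF G 1(1)] by (simp add: t_add t_smult h)
  next
    fix v x assume v: "v \<in> carrier M" and "(p \<odot>\<^bsub>M\<^esub> v, x) \<in> G'"
    then obtain w a e where 1: "(w, a) \<in> G" "e \<in> carrier R"
      "p \<odot>\<^bsub>M\<^esub> v = w \<oplus>\<^bsub>M\<^esub> e \<odot>\<^bsub>M\<^esub> z"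
      unfolding G'_def by blast
    from coeff[OF 1(2,1) v 1(3)[symmetric]]
    obtain d b where d: "d \<in> carrier R" "(v \<ominus>\<^bsub>M\<^esub> d \<odot>\<^bsub>M\<^esub> z, b) \<in> G" by blast
    have "v \<ominus>\<^bsub>M\<^esub> d \<odot>\<^bsub>M\<^esub> z \<oplus>\<^bsub>M\<^esub> d \<odot>\<^bsub>M\<^esub> z = v"
      using v d(1) z by (simp add: M.minus_eq M.a_assoc M.l_neg)
    then show "\<exists>b. (v, b) \<in> G'" using G'I[OF d(2,1)] by auto
  qed
  moreover have "(z, s) \<in> G'" using G'I[OF G0, of \<one>] z s by simp
  moreover have "(z, s) \<notin> G"
    using new[of z s "\<zero>\<^bsub>M\<^esub>"] z p_closed by auto
  ultimately show ?thesis using sub by blast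
qed

text \<open>An element outside \<open>dom + p M\<close> could be adjoined to a maximal partial lift.\<close>

lemma maximal_partial_lift:
  "\<exists>G. partial_lift G \<and> (\<forall>v\<in>carrier M. \<exists>w a u. (w, a) \<in> G \<and> u \<in> carrier M \<and> v = w \<oplus>\<^bsub>M\<^esub> p \<odot>\<^bsub>M\<^esub> u)"
proof -
  have "\<exists>G\<in>{G. partial_lift G}. \<forall>D\<in>{G. partial_lift G}. G \<subseteq> D \<longrightarrow> D = G"
    by (rule subset_Zorn_nonempty) (use partial_lift_start partial_lift_Union in auto)
  then obtain G where "partial_lift G" "\<And>D. partial_lift D \<Longrightarrow> G \<subseteq> D \<Longrightarrow> D = G" by blast
  then show ?thesis using partial_lift_extend by (metis psubsetE subset_refl)
qed

text \<open>Extension by continuity: a dense partial lift determines a value at \<open>v\<close> modulo every power of \<open>p\<close>,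
  namely its value at any element of its domain that is congruent to \<open>v\<close>, and these values converge.\<close>

lemma residual_form_lifts:
  "\<exists>f\<in>module_hom R M (restrict_scalars R (\<lambda>a. a)).
     (\<forall>w\<in>W. f w = \<zero>) \<and> (\<forall>v\<in>carrier M. t v = residue_map R (f v))"
proof -
  obtain G where G: "partial_lift G"
    and dense: "\<And>v. v \<in> carrier M \<Longrightarrow> \<exists>w a u. (w, a) \<in> G \<and> u \<in> carrier M \<and> v = w \<oplus>\<^bsub>M\<^esub> p \<odot>\<^bsub>M\<^esub> u"
    using maximal_partial_lift by metis
  note c = partial_liftD(1,2)[OF G]
  have pn: "p [^] n \<in> carrier R" for n :: nat using p_closed by simp
  have approx: "\<exists>w a u. (w, a) \<in> G \<and> u \<in> carrier M \<and> v = w \<oplus>\<^bsub>M\<^esub> p [^] n \<odot>\<^bsub>M\<^esub> u"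
    if v: "v \<in> carrier M" for v and n :: nat
  proof (induction n)
    case 0
    have "(\<zero>\<^bsub>M\<^esub>, \<zero>) \<in> G"
      using partial_liftD(3)[OF G] subgroup.one_closed[OF Module.submodule.axioms(1)[OF W]] by simp
    then show ?case using v by (intro exI[of _ "\<zero>\<^bsub>M\<^esub>"] exI[of _ \<zero>] exI[of _ v]) simp
  next
    case (Suc n)
    then obtain w a u where 1: "(w, a) \<in> G" "u \<in> carrier M" "v = w \<oplus>\<^bsub>M\<^esub> p [^] n \<odot>\<^bsub>M\<^esub> u" by blast
    obtain w' a' u' where 2: "(w', a') \<in> G" "u' \<in> carrier M" "u = w' \<oplus>\<^bsub>M\<^esub> p \<odot>\<^bsub>M\<^esub> u'"
      using dense[OF 1(2)] by blast
    have "v = (w \<oplus>\<^bsub>M\<^esub> p [^] n \<odot>\<^bsub>M\<^esub> w') \<oplus>\<^bsub>M\<^esub> p [^] Suc n \<odot>\<^bsub>M\<^esub> u'"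
      using c[OF 1(1)] c[OF 2(1)] 2(2) p_closed unfolding 1(3) 2(3)
      by (simp add: M.smult_r_distr M.smult_assoc1 M.a_assoc)
    moreover have "(w \<oplus>\<^bsub>M\<^esub> p [^] n \<odot>\<^bsub>M\<^esub> w', a \<oplus> p [^] n \<otimes> a') \<in> G"
      using 1(1) 2(1) pn by (intro partial_liftD(4,5)[OF G])
    ultimately show ?case using 2(2) by blast
  qed
  \<comment> \<open>\<open>value_of v l\<close> says that \<open>l\<close> is the limit of the partial lift at \<open>v\<close>.\<close>
  define near where "near v n w \<longleftrightarrow> (\<exists>u\<in>carrier M. v = w \<oplus>\<^bsub>M\<^esub> p [^] n \<odot>\<^bsub>M\<^esub> u)" for v w and n :: nat
  define cong where "cong a n b \<longleftrightarrow> (\<exists>d\<in>carrier R. a \<ominus> b = p [^] n \<otimes> d)" for a b and n :: nat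
  define value_of where "value_of v l \<longleftrightarrow> l \<in> carrier R \<and> (\<forall>n w a. (w, a) \<in> G \<longrightarrow> near v n w \<longrightarrow> cong a n l)" for v l
  have near_weaken: "near v m w" if nw: "near v n w" and mn: "m \<le> n" for v m n w
  proof -
    obtain u where u: "u \<in> carrier M" "v = w \<oplus>\<^bsub>M\<^esub> p [^] n \<odot>\<^bsub>M\<^esub> u" using nw unfolding near_def by blast
    have "p [^] n = p [^] m \<otimes> p [^] (n - m)" using mn p_closed by (simp add: nat_pow_mult)
    then have "p [^] n \<odot>\<^bsub>M\<^esub> u = p [^] m \<odot>\<^bsub>M\<^esub> (p [^] (n - m) \<odot>\<^bsub>M\<^esub> u)"
      using u(1) pn by (simp add: M.smult_assoc1)
    then show ?thesis using u pn unfolding near_def by auto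
  qed
  \<comment> \<open>This is where purity enters: the domain meets \<open>p ^ n M\<close> in \<open>p ^ n\<close> times the domain, so the
    partial lift is continuous.\<close>
  have cong_values: "cong a n b" if wa: "(w, a) \<in> G" and xb: "(x, b) \<in> G" and nw: "near v n w" and nx: "near v n x" for v n w x a b
  proof -
    obtain u u' where u: "u \<in> carrier M" "v = w \<oplus>\<^bsub>M\<^esub> p [^] n \<odot>\<^bsub>M\<^esub> u"
      "u' \<in> carrier M" "v = x \<oplus>\<^bsub>M\<^esub> p [^] n \<odot>\<^bsub>M\<^esub> u'" using nw nx unfolding near_def by blast
    have w: "w \<in> carrier M" and x: "x \<in> carrier M" using wa xb c by blast+
    have "w = v \<ominus>\<^bsub>M\<^esub> p [^] n \<odot>\<^bsub>M\<^esub> u"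
      unfolding u(2) using w u(1) pn by (simp add: M.minus_eq M.a_assoc M.r_neg)
    then have "w \<ominus>\<^bsub>M\<^esub> x = (x \<oplus>\<^bsub>M\<^esub> p [^] n \<odot>\<^bsub>M\<^esub> u') \<ominus>\<^bsub>M\<^esub> p [^] n \<odot>\<^bsub>M\<^esub> u \<ominus>\<^bsub>M\<^esub> x"
      using u(4) by simp
    also have "\<dots> = p [^] n \<odot>\<^bsub>M\<^esub> (u' \<ominus>\<^bsub>M\<^esub> u)"
      using x u(1,3) pn by (simp add: M.minus_eq M.smult_r_distr M.smult_r_minus M.a_ac M.r_neg2)
    finally have "(p [^] n \<odot>\<^bsub>M\<^esub> (u' \<ominus>\<^bsub>M\<^esub> u), a \<ominus> b) \<in> G"
      using partial_lift_minus[OF G wa xb] by simp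
    then obtain d where "(u' \<ominus>\<^bsub>M\<^esub> u, d) \<in> G" "a \<ominus> b = p [^] n \<otimes> d"
      using partial_lift_pow[OF G, of "u' \<ominus>\<^bsub>M\<^esub> u"] u by blast
    then show ?thesis unfolding cong_def using c by blast
  qed
  have ex: "\<exists>l. value_of v l" if v: "v \<in> carrier M" for v
  proof -
    obtain w a where wa: "\<And>n. (w n, a n) \<in> G" "\<And>n. near v n (w n)"
      using approx[OF v] unfolding near_def by metis
    have "\<exists>l\<in>carrier R. \<forall>n. \<exists>d\<in>carrier R. a n \<ominus> l = p [^] n \<otimes> d"
    proof (rule adic_limit[OF p_closed max_ideal_eq])
      show "a n \<in> carrier R" for n using c wa by blast
      show "\<exists>d\<in>carrier R. a i \<ominus> a n = p [^] n \<otimes> d" if "n \<le> i" for n i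
        using cong_values[OF wa(1)[of i] wa(1)[of n] near_weaken[OF wa(2) that] wa(2)]
        unfolding cong_def .
    qed
    then obtain l where l: "l \<in> carrier R" "\<And>n. \<exists>d\<in>carrier R. a n \<ominus> l = p [^] n \<otimes> d" by blast
    have "cong b n l" if xb: "(x, b) \<in> G" and nx: "near v n x" for n x b
    proof -
      obtain d where d: "d \<in> carrier R" "b \<ominus> a n = p [^] n \<otimes> d"
        using cong_values[OF xb wa(1)[of n] nx wa(2)] unfolding cong_def by blast
      obtain d' where d': "d' \<in> carrier R" "a n \<ominus> l = p [^] n \<otimes> d'" using l(2) by blast
      have "b \<ominus> l = (b \<ominus> a n) \<oplus> (a n \<ominus> l)"
        using c[OF xb] c[OF wa(1)[of n]] l(1) by algebra
      then have "b \<ominus> l = p [^] n \<otimes> (d \<oplus> d')" using d d' pn by (simp add: r_distr)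
      then show ?thesis unfolding cong_def using d(1) d'(1) by blast
    qed
    then show ?thesis unfolding value_of_def using l(1) by blast
  qed
  \<comment> \<open>A single approximation to each precision determines the limit.\<close>
  have uniq: "l = l'" if l: "value_of v l" "l' \<in> carrier R"
    and l': "\<And>n. \<exists>w a. (w, a) \<in> G \<and> near v n w \<and> cong a n l'" for v l l'
  proof -
    have lc: "l \<in> carrier R" using l unfolding value_of_def by blast
    have "\<exists>d\<in>carrier R. l \<ominus> l' = p [^] n \<otimes> d" for n :: nat
    proof -
      obtain w a where wa: "(w, a) \<in> G" "near v n w" "cong a n l'" using l' by blast
      moreover have "cong a n l" using l wa unfolding value_of_def by blast
      ultimately obtain d d' where d: "d \<in> carrier R" "a \<ominus> l = p [^] n \<otimes> d"
        "d' \<in> carrier R" "a \<ominus> l' = p [^] n \<otimes> d'" unfolding cong_def by blast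
      have "l \<ominus> l' = (a \<ominus> l') \<ominus> (a \<ominus> l)" using c[OF wa(1)] lc l(2) by algebra
      also have "\<dots> = p [^] n \<otimes> (d' \<ominus> d)"
        unfolding d using d(1,3) pn[of n] by algebra
      finally show ?thesis using d(1,3) by blast
    qed
    then have "l \<ominus> l' = \<zero>"
      using infinitely_divisible_imp_zero[OF p_closed max_ideal_eq, of "l \<ominus> l'"] lc l(2) by blast
    then show ?thesis using lc l(2) by simp
  qed
  define f where "f v = (SOME l. value_of v l)" for v
  have f: "value_of v (f v)" if "v \<in> carrier M" for v
    unfolding f_def using ex[OF that] by (rule someI_ex)
  have fc: "f v \<in> carrier R" if "v \<in> carrier M" for v
    using f[OF that] unfolding value_of_def by blast
  have f_cong: "\<exists>w a u d. (w, a) \<in> G \<and> u \<in> carrier M \<and> v = w \<oplus>\<^bsub>M\<^esub> p [^] n \<odot>\<^bsub>M\<^esub> u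
      \<and> d \<in> carrier R \<and> a \<ominus> f v = p [^] n \<otimes> d" if v: "v \<in> carrier M" for v and n :: nat
  proof -
    obtain w a u where 1: "(w, a) \<in> G" "u \<in> carrier M" "v = w \<oplus>\<^bsub>M\<^esub> p [^] n \<odot>\<^bsub>M\<^esub> u"
      using approx[OF v] by blast
    then have "near v n w" unfolding near_def by blast
    then have "cong a n (f v)" using f[OF v] 1(1) unfolding value_of_def by blast
    then show ?thesis using 1 unfolding cong_def by blast
  qed
  have f_G: "f v = a" if va: "(v, a) \<in> G" for v a
  proof (rule uniq[of v])
    have v: "v \<in> carrier M" and a: "a \<in> carrier R" using c[OF va] by auto
    show "value_of v (f v)" by (rule f[OF v])
    show "a \<in> carrier R" by (rule a)
    fix n :: nat
    have "near v n v" unfolding near_def using v pn by (intro bexI[of _ "\<zero>\<^bsub>M\<^esub>"]) auto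
    moreover have "a \<ominus> a = p [^] n \<otimes> \<zero>" using a pn[of n] by algebra
    then have "cong a n a" unfolding cong_def by blast
    ultimately show "\<exists>w b. (w, b) \<in> G \<and> near v n w \<and> cong b n a" using va by blast
  qed
  have f_add: "f (v \<oplus>\<^bsub>M\<^esub> w) = f v \<oplus> f w" if v: "v \<in> carrier M" and w: "w \<in> carrier M" for v w
  proof (rule uniq[of "v \<oplus>\<^bsub>M\<^esub> w"])
    show "value_of (v \<oplus>\<^bsub>M\<^esub> w) (f (v \<oplus>\<^bsub>M\<^esub> w))" using f v w by simp
    show "f v \<oplus> f w \<in> carrier R" using fc v w by simp
    fix n :: nat
    obtain v' a u d where 1: "(v', a) \<in> G" "u \<in> carrier M" "v = v' \<oplus>\<^bsub>M\<^esub> p [^] n \<odot>\<^bsub>M\<^esub> u"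
      "d \<in> carrier R" "a \<ominus> f v = p [^] n \<otimes> d" using f_cong[OF v] by blast
    obtain w' b x e where 2: "(w', b) \<in> G" "x \<in> carrier M" "w = w' \<oplus>\<^bsub>M\<^esub> p [^] n \<odot>\<^bsub>M\<^esub> x"
      "e \<in> carrier R" "b \<ominus> f w = p [^] n \<otimes> e" using f_cong[OF w] by blast
    have "v \<oplus>\<^bsub>M\<^esub> w = (v' \<oplus>\<^bsub>M\<^esub> w') \<oplus>\<^bsub>M\<^esub> p [^] n \<odot>\<^bsub>M\<^esub> (u \<oplus>\<^bsub>M\<^esub> x)"
      unfolding 1(3) 2(3) using c[OF 1(1)] c[OF 2(1)] 1(2) 2(2) pn by (simp add: M.smult_r_distr M.a_ac)
    then have "near (v \<oplus>\<^bsub>M\<^esub> w) n (v' \<oplus>\<^bsub>M\<^esub> w')" unfolding near_def using 1(2) 2(2) by blast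
    moreover have "(a \<oplus> b) \<ominus> (f v \<oplus> f w) = p [^] n \<otimes> (d \<oplus> e)"
    proof -
      have "(a \<oplus> b) \<ominus> (f v \<oplus> f w) = (a \<ominus> f v) \<oplus> (b \<ominus> f w)"
        using c[OF 1(1)] c[OF 2(1)] fc[OF v] fc[OF w] by algebra
      then show ?thesis unfolding 1(5) 2(5) using 1(4) 2(4) pn by (simp add: r_distr)
    qed
    then have "cong (a \<oplus> b) n (f v \<oplus> f w)" unfolding cong_def using 1(4) 2(4) by blast
    ultimately show "\<exists>y b. (y, b) \<in> G \<and> near (v \<oplus>\<^bsub>M\<^esub> w) n y \<and> cong b n (f v \<oplus> f w)"
      using partial_liftD(4)[OF G 1(1) 2(1)] by blast
  qed
  have f_smult: "f (r \<odot>\<^bsub>M\<^esub> v) = r \<otimes> f v" if r: "r \<in> carrier R" and v: "v \<in> carrier M" for r v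
  proof (rule uniq[of "r \<odot>\<^bsub>M\<^esub> v"])
    show "value_of (r \<odot>\<^bsub>M\<^esub> v) (f (r \<odot>\<^bsub>M\<^esub> v))" using f v r by simp
    show "r \<otimes> f v \<in> carrier R" using fc v r by simp
    fix n :: nat
    obtain v' a u d where 1: "(v', a) \<in> G" "u \<in> carrier M" "v = v' \<oplus>\<^bsub>M\<^esub> p [^] n \<odot>\<^bsub>M\<^esub> u"
      "d \<in> carrier R" "a \<ominus> f v = p [^] n \<otimes> d" using f_cong[OF v] by blast
    have "r \<odot>\<^bsub>M\<^esub> v = r \<odot>\<^bsub>M\<^esub> v' \<oplus>\<^bsub>M\<^esub> p [^] n \<odot>\<^bsub>M\<^esub> (r \<odot>\<^bsub>M\<^esub> u)"
      unfolding 1(3) using c[OF 1(1)] 1(2) pn r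
      by (simp add: M.smult_r_distr M.smult_assoc1[symmetric] m_comm)
    then have "near (r \<odot>\<^bsub>M\<^esub> v) n (r \<odot>\<^bsub>M\<^esub> v')" unfolding near_def using 1(2) r by blast
    moreover have "(r \<otimes> a) \<ominus> (r \<otimes> f v) = p [^] n \<otimes> (r \<otimes> d)"
    proof -
      have "(r \<otimes> a) \<ominus> (r \<otimes> f v) = r \<otimes> (a \<ominus> f v)"
        using c[OF 1(1)] fc[OF v] r by algebra
      then show ?thesis unfolding 1(5) using 1(4) pn r by (simp add: m_lcomm)
    qed
    then have "cong (r \<otimes> a) n (r \<otimes> f v)" unfolding cong_def using 1(4) r by blast
    ultimately show "\<exists>y b. (y, b) \<in> G \<and> near (r \<odot>\<^bsub>M\<^esub> v) n y \<and> cong b n (r \<otimes> f v)"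
      using partial_liftD(5)[OF G r 1(1)] by blast
  qed
  have red: "t v = residue_map R (f v)" if v: "v \<in> carrier M" for v
  proof -
    obtain w a u d where 1: "(w, a) \<in> G" "u \<in> carrier M" "v = w \<oplus>\<^bsub>M\<^esub> p [^] (1::nat) \<odot>\<^bsub>M\<^esub> u"
      "d \<in> carrier R" "a \<ominus> f v = p [^] (1::nat) \<otimes> d" using f_cong[OF v] by blast
    have "t v = t w" using 1(2,3) c[OF 1(1)] p_closed by (simp add: t_add_p_smult)
    also have "\<dots> = residue_map R a" by (rule partial_liftD(7)[OF G 1(1)])
    also have "\<dots> = residue_map R (f v)"
      by (rule residue_eqI[OF _ fc[OF v] 1(4)]) (use c[OF 1(1)] 1(5) p_closed in simp_all)
    finally show ?thesis .
  qed
  have "f \<in> module_hom R M (restrict_scalars R (\<lambda>a. a))"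
    unfolding module_hom_def restrict_scalars_def using f_add f_smult fc by simp
  moreover have "\<forall>w\<in>W. f w = \<zero>" using f_G partial_liftD(3)[OF G] by blast
  ultimately show ?thesis using red by blast
qed

end

section \<open>Compact open subgroups\<close>

lemma (in group) inv_mult_cancel:
  "x \<in> carrier G \<Longrightarrow> y \<in> carrier G \<Longrightarrow> inv x \<otimes> (x \<otimes> y) = y"
  by (simp add: m_assoc[symmetric])

lemma (in group) mult_inv_cancel:
  "x \<in> carrier G \<Longrightarrow> y \<in> carrier G \<Longrightarrow> x \<otimes> (inv x \<otimes> y) = y"
  by (simp add: m_assoc[symmetric])

context topological_group
begin

lemma openin_preimage_mult:
  assumes U: "openin T U" and g: "g \<in> carrier G" "h \<in> carrier G"
  shows "openin T {x \<in> carrier G. g \<otimes> x \<otimes> h \<in> U}"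
proof -
  have const: "continuous_map T T (\<lambda>x. a)" if "a \<in> carrier G" for a
    using that by (simp add: topspace_eq)
  have mult: "continuous_map T T (\<lambda>x. a x \<otimes> b x)"
    if "continuous_map T T a" "continuous_map T T b" for a b
    using continuous_map_compose[OF continuous_map_pairedI[OF that] continuous_mult]
    by (simp add: o_def)
  have "continuous_map T T (\<lambda>x. g \<otimes> x \<otimes> h)"
    by (intro mult const g) (simp add: continuous_map_id[unfolded id_def])
  then show ?thesis
    using openin_continuous_map_preimage[OF _ U, of T "\<lambda>x. g \<otimes> x \<otimes> h"] by (simp add: topspace_eq)
qed

text \<open>The right cosets are open, disjoint and cover \<open>K\<close>.\<close>

lemma finite_rcosets_compact:
  assumes K: "subgroup K G" "compactin T K" and U: "subgroup U G" "openin T U" "U \<subseteq> K"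
  shows "finite (rcosets\<^bsub>G\<lparr>carrier := K\<rparr>\<^esub> U)"
proof -
  have KG: "K \<subseteq> carrier G" using K(1) by (rule subgroup.subset)
  have eq: "rcosets\<^bsub>G\<lparr>carrier := K\<rparr>\<^esub> U = (\<lambda>g. U #> g) ` K"
    by (auto simp: RCOSETS_def r_coset_def)
  have op: "openin T (U #> g)" if g: "g \<in> K" for g
  proof -
    have gG: "g \<in> carrier G" using g KG by blast
    have "U #> g = {x \<in> carrier G. \<one> \<otimes> x \<otimes> inv g \<in> U}"
    proof (intro Set.set_eqI iffI)
      fix x assume "x \<in> U #> g"
      then obtain u where "u \<in> U" "x = u \<otimes> g" by (auto simp: r_coset_def)
      then show "x \<in> {x \<in> carrier G. \<one> \<otimes> x \<otimes> inv g \<in> U}"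
        using gG subgroup.mem_carrier[OF U(1)] by (simp add: m_assoc)
    next
      fix x assume "x \<in> {x \<in> carrier G. \<one> \<otimes> x \<otimes> inv g \<in> U}"
      then have "x \<otimes> inv g \<in> U" "x = (x \<otimes> inv g) \<otimes> g" using gG by (auto simp: m_assoc)
      then show "x \<in> U #> g" unfolding r_coset_def by blast
    qed
    then show ?thesis using openin_preimage_mult[OF U(2)] gG by simp
  qed
  have self: "g \<in> U #> g" if "g \<in> K" for g
    using that KG rcos_self[OF _ U(1)] by blast
  obtain F where F: "finite F" "F \<subseteq> (\<lambda>g. U #> g) ` K" "K \<subseteq> \<Union>F"
    using compactinD[OF K(2), of "(\<lambda>g. U #> g) ` K"] op self by blast
  have "(\<lambda>g. U #> g) ` K \<subseteq> F"
  proof (rule image_subsetI)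
    fix g assume g: "g \<in> K"
    then obtain C where C: "C \<in> F" "g \<in> C" using F(3) by blast
    then obtain h where "h \<in> K" "C = U #> h" using F(2) by blast
    then have h: "h \<in> K" "U #> h \<in> F" "g \<in> U #> h" using C by simp_all
    then have "U #> h = U #> g" using repr_independence[OF h(3) _ U(1)] KG by blast
    then show "U #> g \<in> F" using h by simp
  qed
  then show ?thesis unfolding eq using F(1) finite_subset by blast
qed

text \<open>The conjugates of \<open>U \<inter> K\<close> under \<open>K\<close> depend only on a coset of \<open>U \<inter> K\<close>, hence there are finitely many of
  them and their intersection is open.\<close>

lemma open_normal_core:
  assumes K: "subgroup K G" "compactin T K" "openin T K" and U: "subgroup U G" "openin T U"
  shows "\<exists>C. subgroup C G \<and> openin T C \<and> C \<subseteq> U \<and> C \<subseteq> K \<and>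
    (\<forall>g\<in>K. \<forall>x\<in>C. g \<otimes> x \<otimes> inv g \<in> C)"
proof -
  have KG: "K \<subseteq> carrier G" using K(1) by (rule subgroup.subset)
  define V where "V = U \<inter> K"
  have V: "subgroup V G" "openin T V" "V \<subseteq> K"
    unfolding V_def using subgroups_Inter_pair[OF U(1) K(1)] U(2) K(3) by auto
  define conj_V where "conj_V g = {x \<in> carrier G. g \<otimes> x \<otimes> inv g \<in> V}" for g
  have VG: "x \<in> carrier G" if "x \<in> V" for x using subgroup.mem_carrier[OF V(1) that] .
  have conj_V_coset: "conj_V h = conj_V g" if h: "h \<in> V #> g" and g: "g \<in> K" for g h
  proof -
    have gG: "g \<in> carrier G" using g KG by blast
    obtain u where u: "u \<in> V" "h = u \<otimes> g" using h by (auto simp: r_coset_def)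
    have uG: "u \<in> carrier G" using VG u(1) by simp
    have "(h \<otimes> x \<otimes> inv h \<in> V) = (g \<otimes> x \<otimes> inv g \<in> V)" if x: "x \<in> carrier G" for x
    proof -
      have 1: "h \<otimes> x \<otimes> inv h = u \<otimes> (g \<otimes> x \<otimes> inv g) \<otimes> inv u"
        unfolding u(2) using uG gG x by (simp add: inv_mult_group m_assoc)
      have 2: "g \<otimes> x \<otimes> inv g = inv u \<otimes> (h \<otimes> x \<otimes> inv h) \<otimes> u"
        unfolding 1 using uG gG x by (simp add: m_assoc inv_mult_cancel)
      have i: "inv u \<in> V" using subgroup.m_inv_closed[OF V(1) u(1)] .
      show ?thesis
        using 1 2 i u(1) subgroup.m_closed[OF V(1)] by metis
    qed
    then show ?thesis unfolding conj_V_def by blast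
  qed
  have "conj_V ` K \<subseteq> (\<lambda>C. conj_V (SOME h. h \<in> C)) ` (rcosets\<^bsub>G\<lparr>carrier := K\<rparr>\<^esub> V)"
  proof (rule image_subsetI)
    fix g assume g: "g \<in> K"
    have "g \<in> V #> g" using g KG rcos_self[OF _ V(1)] by blast
    then have "(SOME h. h \<in> V #> g) \<in> V #> g" by (rule someI)
    then have "conj_V g = conj_V (SOME h. h \<in> V #> g)" using conj_V_coset g by blast
    moreover have "V #> g \<in> rcosets\<^bsub>G\<lparr>carrier := K\<rparr>\<^esub> V"
      using g by (auto simp: RCOSETS_def r_coset_def)
    ultimately show "conj_V g \<in> (\<lambda>C. conj_V (SOME h. h \<in> C)) ` (rcosets\<^bsub>G\<lparr>carrier := K\<rparr>\<^esub> V)" by blast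
  qed
  then have fin: "finite (conj_V ` K)"
    using finite_rcosets_compact[OF K(1,2) V] finite_surj by blast
  have oneK: "\<one> \<in> K" using subgroup.one_closed[OF K(1)] .
  define C where "C = \<Inter>(conj_V ` K)"
  have CI: "x \<in> C" if "x \<in> carrier G" "\<And>g. g \<in> K \<Longrightarrow> g \<otimes> x \<otimes> inv g \<in> V" for x
    using that unfolding C_def conj_V_def by blast
  have CD: "x \<in> carrier G" "g \<in> K \<Longrightarrow> g \<otimes> x \<otimes> inv g \<in> V" if x: "x \<in> C" for x g
    using x oneK unfolding C_def conj_V_def by blast+
  have "openin T C"
    unfolding C_def
  proof (rule openin_Inter)
    show "finite (conj_V ` K)" by (rule fin)
    show "conj_V ` K \<noteq> {}" using oneK by blast
    show "openin T Y" if "Y \<in> conj_V ` K" for Y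
      using that openin_preimage_mult[OF V(2)] KG unfolding conj_V_def by blast
  qed
  moreover have CV: "C \<subseteq> V"
  proof
    fix x assume "x \<in> C"
    then show "x \<in> V" using CD(1) CD(2)[of x \<one>] oneK by simp
  qed
  moreover have "subgroup C G"
  proof (rule subgroupI)
    show "C \<subseteq> carrier G" using CD(1) by blast
    have "\<one> \<in> C" using subgroup.one_closed[OF V(1)] KG by (intro CI) (auto simp: subsetD)
    then show "C \<noteq> {}" by blast
  next
    fix x assume x: "x \<in> C"
    show "inv x \<in> C"
    proof (rule CI)
      show "inv x \<in> carrier G" using CD(1)[OF x] by simp
      fix g assume g: "g \<in> K"
      have "g \<otimes> inv x \<otimes> inv g = inv (g \<otimes> x \<otimes> inv g)"
        using CD(1)[OF x] g KG by (simp add: inv_mult_group m_assoc subsetD)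
      then show "g \<otimes> inv x \<otimes> inv g \<in> V"
        using subgroup.m_inv_closed[OF V(1) CD(2)[OF x g]] by simp
    qed
  next
    fix x y assume x: "x \<in> C" and y: "y \<in> C"
    show "x \<otimes> y \<in> C"
    proof (rule CI)
      show "x \<otimes> y \<in> carrier G" using CD(1)[OF x] CD(1)[OF y] by simp
      fix g assume g: "g \<in> K"
      then have gG: "g \<in> carrier G" using KG by blast
      have "g \<otimes> (x \<otimes> y) \<otimes> inv g = (g \<otimes> x \<otimes> inv g) \<otimes> (g \<otimes> y \<otimes> inv g)"
        using CD(1)[OF x] CD(1)[OF y] gG by (simp add: m_assoc inv_mult_cancel)
      then show "g \<otimes> (x \<otimes> y) \<otimes> inv g \<in> V"
        using subgroup.m_closed[OF V(1) CD(2)[OF x g] CD(2)[OF y g]] by simp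
    qed
  qed
  moreover have "k \<otimes> x \<otimes> inv k \<in> C" if k: "k \<in> K" and x: "x \<in> C" for k x
  proof (rule CI)
    have kG: "k \<in> carrier G" using k KG by blast
    show "k \<otimes> x \<otimes> inv k \<in> carrier G" using CD(1)[OF x] kG by simp
    fix g assume g: "g \<in> K"
    then have gG: "g \<in> carrier G" using KG by blast
    have "g \<otimes> (k \<otimes> x \<otimes> inv k) \<otimes> inv g = (g \<otimes> k) \<otimes> x \<otimes> inv (g \<otimes> k)"
      using CD(1)[OF x] kG gG by (simp add: inv_mult_group m_assoc)
    then show "g \<otimes> (k \<otimes> x \<otimes> inv k) \<otimes> inv g \<in> V"
      using CD(2)[OF x subgroup.m_closed[OF K(1) g k]] by simp
  qed
  ultimately show ?thesis unfolding V_def by blast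
qed

end

section \<open>Coinvariants of a smooth action\<close>

locale smooth_linear_action = N?: topological_group N \<T> + M?: Module.module A M
  for N (structure) and \<T> and A and M +
  fixes \<sigma> :: "'a \<Rightarrow> 'e \<Rightarrow> 'e"
  assumes \<sigma>_hom: "n \<in> carrier N \<Longrightarrow> \<sigma> n \<in> module_hom A M M"
    and \<sigma>_one: "v \<in> carrier M \<Longrightarrow> \<sigma> \<one> v = v"
    and \<sigma>_mult: "g \<in> carrier N \<Longrightarrow> h \<in> carrier N \<Longrightarrow> v \<in> carrier M \<Longrightarrow> \<sigma> (g \<otimes> h) v = \<sigma> g (\<sigma> h v)"
    and \<sigma>_smooth: "v \<in> carrier M \<Longrightarrow> \<exists>U. subgroup U N \<and> openin \<T> U \<and> (\<forall>u\<in>U. \<sigma> u v = v)"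
begin

text \<open>The quotient of \<open>M\<close> by this submodule is the module of coinvariants.\<close>

inductive_set augmentation :: "'e set" where
  diff: "n \<in> carrier N \<Longrightarrow> v \<in> carrier M \<Longrightarrow> \<sigma> n v \<ominus>\<^bsub>M\<^esub> v \<in> augmentation"
| add: "v \<in> augmentation \<Longrightarrow> w \<in> augmentation \<Longrightarrow> v \<oplus>\<^bsub>M\<^esub> w \<in> augmentation"
| smult: "a \<in> carrier A \<Longrightarrow> v \<in> augmentation \<Longrightarrow> a \<odot>\<^bsub>M\<^esub> v \<in> augmentation"

lemma \<sigma>_closed [simp]: "n \<in> carrier N \<Longrightarrow> v \<in> carrier M \<Longrightarrow> \<sigma> n v \<in> carrier M"
  using module_hom_closed[OF \<sigma>_hom] by blast

lemma \<sigma>_add: "n \<in> carrier N \<Longrightarrow> v \<in> carrier M \<Longrightarrow> w \<in> carrier M \<Longrightarrow> \<sigma> n (v \<oplus>\<^bsub>M\<^esub> w) = \<sigma> n v \<oplus>\<^bsub>M\<^esub> \<sigma> n w"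
  using module_hom_add[OF \<sigma>_hom] by blast

lemma \<sigma>_smult: "n \<in> carrier N \<Longrightarrow> a \<in> carrier A \<Longrightarrow> v \<in> carrier M \<Longrightarrow> \<sigma> n (a \<odot>\<^bsub>M\<^esub> v) = a \<odot>\<^bsub>M\<^esub> \<sigma> n v"
  using module_hom_smult[OF \<sigma>_hom] by blast

lemma augmentation_closed: "v \<in> augmentation \<Longrightarrow> v \<in> carrier M"
  by (induction rule: augmentation.induct) auto

lemma augmentation_submodule: "Module.submodule augmentation A M"
proof (rule M.submoduleI)
  show "augmentation \<subseteq> carrier M" using augmentation_closed by blast
  have "\<sigma> \<one> \<zero>\<^bsub>M\<^esub> \<ominus>\<^bsub>M\<^esub> \<zero>\<^bsub>M\<^esub> \<in> augmentation" by (rule augmentation.diff) auto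
  then show "\<zero>\<^bsub>M\<^esub> \<in> augmentation" by (simp add: \<sigma>_one M.minus_eq M.r_neg del: M.l_zero)
  fix v assume v: "v \<in> augmentation"
  have "(\<ominus>\<^bsub>A\<^esub> \<one>\<^bsub>A\<^esub>) \<odot>\<^bsub>M\<^esub> v \<in> augmentation" using v by (intro augmentation.smult) auto
  then show "\<ominus>\<^bsub>M\<^esub> v \<in> augmentation"
    using augmentation_closed[OF v] by (simp add: M.smult_l_minus)
qed (auto intro: augmentation.intros)

lemma minus_zero_M: "\<ominus>\<^bsub>M\<^esub> \<zero>\<^bsub>M\<^esub> = \<zero>\<^bsub>M\<^esub>"
  by (metis M.l_zero M.r_neg M.zero_closed M.a_inv_closed)

text \<open>On the vectors fixed by \<open>U\<close> this is the trace from \<open>U\<close> to \<open>K\<close>, whatever the representatives are.  The inverse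
  is there because the cosets \<open>U g\<close> are right cosets.  With one choice of representatives for all vectors, the
  sum is linear on the whole of \<open>M\<close>.\<close>

definition coset_sum :: "'a set \<Rightarrow> 'a set \<Rightarrow> 'e \<Rightarrow> 'e" where
  "coset_sum K U v = (\<Oplus>\<^bsub>M\<^esub>C\<in>rcosets\<^bsub>N\<lparr>carrier := K\<rparr>\<^esub> U. \<sigma> (inv (SOME g. g \<in> C)) v)"

lemma coset_representative:
  assumes "subgroup K N" "subgroup U N" "U \<subseteq> K" "C \<in> rcosets\<^bsub>N\<lparr>carrier := K\<rparr>\<^esub> U"
  shows "(SOME g. g \<in> C) \<in> C" "C \<subseteq> K" "C = U #> (SOME g. g \<in> C)"
proof -
  obtain g where g: "g \<in> K" "C = U #> g"
    using assms(4) by (auto simp: RCOSETS_def r_coset_def)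
  have gN: "g \<in> carrier N" using subgroup.mem_carrier[OF assms(1) g(1)] .
  have "g \<in> C" unfolding g(2) by (rule rcos_self[OF gN assms(2)])
  then show s: "(SOME g. g \<in> C) \<in> C" by (rule someI)
  show "C \<subseteq> K"
    unfolding g(2) r_coset_def using subgroup.m_closed[OF assms(1)] g(1) assms(3) by blast
  show "C = U #> (SOME g. g \<in> C)"
    using repr_independence[OF _ gN assms(2), of "SOME g. g \<in> C"] s g(2) by simp
qed

lemma coset_sum_summand_closed:
  assumes "subgroup K N" "subgroup U N" "U \<subseteq> K" "C \<in> rcosets\<^bsub>N\<lparr>carrier := K\<rparr>\<^esub> U"
  shows "(SOME g. g \<in> C) \<in> carrier N" "v \<in> carrier M \<Longrightarrow> \<sigma> (inv (SOME g. g \<in> C)) v \<in> carrier M"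
proof -
  show s: "(SOME g. g \<in> C) \<in> carrier N"
    using coset_representative(1,2)[OF assms] subgroup.subset[OF assms(1)] by blast
  then show "v \<in> carrier M \<Longrightarrow> \<sigma> (inv (SOME g. g \<in> C)) v \<in> carrier M" by simp
qed

lemma coset_sum_add:
  assumes "subgroup K N" "subgroup U N" "U \<subseteq> K" "v \<in> carrier M" "w \<in> carrier M"
  shows "coset_sum K U (v \<oplus>\<^bsub>M\<^esub> w) = coset_sum K U v \<oplus>\<^bsub>M\<^esub> coset_sum K U w"
proof -
  note s = coset_sum_summand_closed[OF assms(1-3)]
  have "coset_sum K U (v \<oplus>\<^bsub>M\<^esub> w) = (\<Oplus>\<^bsub>M\<^esub>C\<in>rcosets\<^bsub>N\<lparr>carrier := K\<rparr>\<^esub> U.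
      \<sigma> (inv (SOME g. g \<in> C)) v \<oplus>\<^bsub>M\<^esub> \<sigma> (inv (SOME g. g \<in> C)) w)"
    unfolding coset_sum_def
    by (rule M.add.finprod_cong') (use s assms(4,5) in \<open>auto simp: \<sigma>_add\<close>)
  also have "\<dots> = coset_sum K U v \<oplus>\<^bsub>M\<^esub> coset_sum K U w"
    unfolding coset_sum_def by (rule M.finsum_addf) (use s(2) assms(4,5) in auto)
  finally show ?thesis .
qed

lemma coset_sum_smult:
  assumes "subgroup K N" "subgroup U N" "U \<subseteq> K" "finite (rcosets\<^bsub>N\<lparr>carrier := K\<rparr>\<^esub> U)"
    "a \<in> carrier A" "v \<in> carrier M"
  shows "coset_sum K U (a \<odot>\<^bsub>M\<^esub> v) = a \<odot>\<^bsub>M\<^esub> coset_sum K U v"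
proof -
  note s = coset_sum_summand_closed[OF assms(1-3)]
  have "coset_sum K U (a \<odot>\<^bsub>M\<^esub> v) = (\<Oplus>\<^bsub>M\<^esub>C\<in>rcosets\<^bsub>N\<lparr>carrier := K\<rparr>\<^esub> U.
      a \<odot>\<^bsub>M\<^esub> \<sigma> (inv (SOME g. g \<in> C)) v)"
    unfolding coset_sum_def
    by (rule M.add.finprod_cong') (use s assms(5,6) in \<open>auto simp: \<sigma>_smult\<close>)
  also have "\<dots> = a \<odot>\<^bsub>M\<^esub> coset_sum K U v"
    unfolding coset_sum_def
    by (rule M.finsum_smult_ldistr[symmetric]) (use assms s(2) in auto)
  finally show ?thesis .
qed

lemma coset_sum_closed:
  assumes "subgroup K N" "subgroup U N" "U \<subseteq> K" "v \<in> carrier M"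
  shows "coset_sum K U v \<in> carrier M"
  unfolding coset_sum_def
  by (rule M.finsum_closed) (use coset_sum_summand_closed(2)[OF assms(1-3)] assms(4) in auto)

text \<open>As \<open>U\<close> is normal in \<open>K\<close>, translation by \<open>n\<inverse>\<close> permutes the right cosets; the summand of \<open>\<sigma> n v\<close> at the coset
  \<open>C\<close> is the summand of \<open>v\<close> at \<open>n\<inverse> C\<close>.\<close>

lemma coset_sum_translate:
  assumes K: "subgroup K N" and U: "subgroup U N" "U \<subseteq> K"
    and normal: "\<And>g x. g \<in> K \<Longrightarrow> x \<in> U \<Longrightarrow> g \<otimes> x \<otimes> inv g \<in> U"
    and v: "v \<in> carrier M" "\<And>u. u \<in> U \<Longrightarrow> \<sigma> u v = v" and n: "n \<in> K"
  shows "coset_sum K U (\<sigma> n v) = coset_sum K U v"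
proof -
  let ?RC = "rcosets\<^bsub>N\<lparr>carrier := K\<rparr>\<^esub> U"
  have KN: "K \<subseteq> carrier N" using K by (rule subgroup.subset)
  have UN: "U \<subseteq> carrier N" using U(1) by (rule subgroup.subset)
  note rep = coset_representative[OF K U] coset_sum_summand_closed[OF K U]
  have nN: "n \<in> carrier N" using n KN by blast
  have translate: "m <# (U #> g) = U #> (m \<otimes> g)" if m: "m \<in> K" and g: "g \<in> K" for m g
  proof (intro Set.set_eqI iffI)
    have mN: "m \<in> carrier N" and gN: "g \<in> carrier N" using m g KN by auto
    fix x
    {
      assume "x \<in> m <# (U #> g)"
      then obtain u where u: "u \<in> U" "x = m \<otimes> (u \<otimes> g)" by (auto simp: l_coset_def r_coset_def)
      then have "x = (m \<otimes> u \<otimes> inv m) \<otimes> (m \<otimes> g)"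
        using mN gN subsetD[OF UN u(1)] by (simp add: N.m_assoc inv_mult_cancel)
      then show "x \<in> U #> (m \<otimes> g)" using normal[OF m u(1)] unfolding r_coset_def by blast
    next
      assume "x \<in> U #> (m \<otimes> g)"
      then obtain u where u: "u \<in> U" "x = u \<otimes> (m \<otimes> g)" by (auto simp: r_coset_def)
      have i: "inv m \<otimes> u \<otimes> m \<in> U"
        using normal[OF subgroup.m_inv_closed[OF K m] u(1)] mN by simp
      have "x = m \<otimes> ((inv m \<otimes> u \<otimes> m) \<otimes> g)"
        using mN gN subsetD[OF UN u(1)] u(2) by (simp add: N.m_assoc mult_inv_cancel)
      then show "x \<in> m <# (U #> g)" using i unfolding l_coset_def r_coset_def by blast
    }
  qed
  have in_RC: "m <# C \<in> ?RC" if m: "m \<in> K" and C: "C \<in> ?RC" for m C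
  proof -
    obtain g where g: "g \<in> K" "C = U #> g" using C by (auto simp: RCOSETS_def r_coset_def)
    have "m \<otimes> g \<in> K" using subgroup.m_closed[OF K m g(1)] .
    then show ?thesis unfolding g(2) translate[OF m g(1)] by (auto simp: RCOSETS_def r_coset_def)
  qed
  have cancel: "m <# (inv m <# C) = C" if m: "m \<in> K" and C: "C \<in> ?RC" for m C
  proof -
    have "C \<subseteq> carrier N" using rep(2)[OF C] KN by blast
    then show ?thesis
      using lcos_m_assoc[of C m "inv m"] lcos_mult_one[of C] m KN by (simp add: subsetD)
  qed
  have iK: "inv n \<in> K" using subgroup.m_inv_closed[OF K n] .
  have bij: "bij_betw (\<lambda>C. inv n <# C) ?RC ?RC"
  proof (rule bij_betwI[where g = "\<lambda>C. n <# C"])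
    show "(\<lambda>C. inv n <# C) \<in> ?RC \<rightarrow> ?RC" using in_RC[OF iK] by blast
    show "(\<lambda>C. n <# C) \<in> ?RC \<rightarrow> ?RC" using in_RC[OF n] by blast
    show "n <# (inv n <# C) = C" if "C \<in> ?RC" for C using cancel[OF n that] .
    show "inv n <# (n <# C) = C" if "C \<in> ?RC" for C using cancel[OF iK that] nN by simp
  qed
  have any_rep: "\<sigma> (inv (SOME g. g \<in> C)) v = \<sigma> (inv h) v" if C: "C \<in> ?RC" and h: "h \<in> C" for C h
  proof -
    have hN: "h \<in> carrier N" using rep(2)[OF C] h KN by blast
    have "h \<in> U #> (SOME g. g \<in> C)" using rep(3)[OF C] h by simp
    then obtain u where u: "u \<in> U" "h = u \<otimes> (SOME g. g \<in> C)" by (auto simp: r_coset_def)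
    have uN: "u \<in> carrier N" and iu: "inv u \<in> U" using u(1) UN subgroup.m_inv_closed[OF U(1)] by auto
    have "\<sigma> (inv h) v = \<sigma> (inv (SOME g. g \<in> C)) (\<sigma> (inv u) v)"
      unfolding u(2) using uN rep(4)[OF C] v(1) by (simp add: inv_mult_group \<sigma>_mult)
    then show ?thesis using v(2)[OF iu] by simp
  qed
  have "coset_sum K U (\<sigma> n v) = (\<Oplus>\<^bsub>M\<^esub>C\<in>?RC. \<sigma> (inv (SOME g. g \<in> inv n <# C)) v)"
    unfolding coset_sum_def
  proof (rule M.add.finprod_cong')
    show "(\<lambda>C. \<sigma> (inv (SOME g. g \<in> inv n <# C)) v) \<in> ?RC \<rightarrow> carrier M"
      using rep(5)[OF in_RC[OF iK]] v(1) by blast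
    fix C assume C: "C \<in> ?RC"
    let ?g = "SOME g. g \<in> C"
    have gN: "?g \<in> carrier N" by (rule rep(4)[OF C])
    have "inv n \<otimes> ?g \<in> inv n <# C" using rep(1)[OF C] unfolding l_coset_def by blast
    then have "\<sigma> (inv (SOME g. g \<in> inv n <# C)) v = \<sigma> (inv (inv n \<otimes> ?g)) v"
      by (rule any_rep[OF in_RC[OF iK C]])
    also have "\<dots> = \<sigma> (inv ?g) (\<sigma> n v)"
      using gN nN v(1) by (simp add: inv_mult_group \<sigma>_mult)
    finally show "\<sigma> (inv ?g) (\<sigma> n v) = \<sigma> (inv (SOME g. g \<in> inv n <# C)) v" by simp
  qed simp
  also have "\<dots> = (\<Oplus>\<^bsub>M\<^esub>C\<in>(\<lambda>C. inv n <# C) ` ?RC. \<sigma> (inv (SOME g. g \<in> C)) v)"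
  proof (rule M.finsum_reindex[symmetric])
    show "(\<lambda>C. \<sigma> (inv (SOME g. g \<in> C)) v) \<in> (\<lambda>C. inv n <# C) ` ?RC \<rightarrow> carrier M"
      using rep(5)[OF in_RC[OF iK]] v(1) by blast
    show "inj_on (\<lambda>C. inv n <# C) ?RC" using bij by (rule bij_betw_imp_inj_on)
  qed
  also have "\<dots> = coset_sum K U v"
    unfolding coset_sum_def bij_betw_imp_surj_on[OF bij] ..
  finally show ?thesis .
qed

text \<open>The finite set \<open>F\<close> collects the group elements that occur in an expression of \<open>v\<close> by generators, and
  \<open>U\<^sub>0\<close> fixes the vectors that occur.  Quantifying over all large \<open>K\<close> and small \<open>U\<close> lets the bounds for two
  elements be combined.\<close>

lemma coset_sum_augmentation_eventually_zero:
  assumes "v \<in> augmentation"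
  shows "\<exists>F U\<^sub>0. finite F \<and> F \<subseteq> carrier N \<and> subgroup U\<^sub>0 N \<and> openin \<T> U\<^sub>0 \<and>
    (\<forall>K U. subgroup K N \<longrightarrow> compactin \<T> K \<longrightarrow> F \<subseteq> K \<longrightarrow>
       subgroup U N \<longrightarrow> openin \<T> U \<longrightarrow> U \<subseteq> K \<longrightarrow> U \<subseteq> U\<^sub>0 \<longrightarrow>
       (\<forall>g\<in>K. \<forall>x\<in>U. g \<otimes> x \<otimes> inv g \<in> U) \<longrightarrow> coset_sum K U v = \<zero>\<^bsub>M\<^esub>)"
  using assms
proof induction
  case (diff n v)
  obtain U\<^sub>0 where U\<^sub>0: "subgroup U\<^sub>0 N" "openin \<T> U\<^sub>0" "\<And>u. u \<in> U\<^sub>0 \<Longrightarrow> \<sigma> u v = v"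
    using \<sigma>_smooth[OF diff(2)] by blast
  have "coset_sum K U (\<sigma> n v \<ominus>\<^bsub>M\<^esub> v) = \<zero>\<^bsub>M\<^esub>"
    if K: "subgroup K N" "compactin \<T> K" "{n} \<subseteq> K" and U: "subgroup U N" "openin \<T> U" "U \<subseteq> K" "U \<subseteq> U\<^sub>0"
      and nor: "\<forall>g\<in>K. \<forall>x\<in>U. g \<otimes> x \<otimes> inv g \<in> U" for K U
  proof -
    have fin: "finite (rcosets\<^bsub>N\<lparr>carrier := K\<rparr>\<^esub> U)"
      by (rule finite_rcosets_compact[OF K(1,2) U(1-3)])
    have tr: "coset_sum K U (\<sigma> n v) = coset_sum K U v"
      by (rule coset_sum_translate[OF K(1) U(1,3)]) (use nor diff(2) U\<^sub>0(3) U(4) K(3) in auto)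
    have "\<sigma> n v \<ominus>\<^bsub>M\<^esub> v = \<sigma> n v \<oplus>\<^bsub>M\<^esub> (\<ominus>\<^bsub>A\<^esub> \<one>\<^bsub>A\<^esub>) \<odot>\<^bsub>M\<^esub> v"
      using diff by (simp add: M.minus_eq M.smult_l_minus)
    then have "coset_sum K U (\<sigma> n v \<ominus>\<^bsub>M\<^esub> v)
        = coset_sum K U v \<oplus>\<^bsub>M\<^esub> (\<ominus>\<^bsub>A\<^esub> \<one>\<^bsub>A\<^esub>) \<odot>\<^bsub>M\<^esub> coset_sum K U v"
      using diff tr coset_sum_smult[OF K(1) U(1,3) fin, of "\<ominus>\<^bsub>A\<^esub> \<one>\<^bsub>A\<^esub>" v]
      by (simp add: coset_sum_add[OF K(1) U(1,3)])
    then show ?thesis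
      using coset_sum_closed[OF K(1) U(1,3) diff(2)] by (simp add: M.smult_l_minus M.r_neg)
  qed
  with U\<^sub>0(1,2) diff(1) show ?case by - (rule exI[of _ "{n}"], rule exI[of _ U\<^sub>0], simp)
next
  case (add v w)
  obtain F U where 1: "finite F" "F \<subseteq> carrier N" "subgroup U N" "openin \<T> U"
    "\<And>K U'. \<lbrakk>subgroup K N; compactin \<T> K; F \<subseteq> K; subgroup U' N; openin \<T> U'; U' \<subseteq> K; U' \<subseteq> U;
      \<forall>g\<in>K. \<forall>x\<in>U'. g \<otimes> x \<otimes> inv g \<in> U'\<rbrakk> \<Longrightarrow> coset_sum K U' v = \<zero>\<^bsub>M\<^esub>"
    using add.IH(1) by metis
  obtain F' V where 2: "finite F'" "F' \<subseteq> carrier N" "subgroup V N" "openin \<T> V"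
    "\<And>K U'. \<lbrakk>subgroup K N; compactin \<T> K; F' \<subseteq> K; subgroup U' N; openin \<T> U'; U' \<subseteq> K; U' \<subseteq> V;
      \<forall>g\<in>K. \<forall>x\<in>U'. g \<otimes> x \<otimes> inv g \<in> U'\<rbrakk> \<Longrightarrow> coset_sum K U' w = \<zero>\<^bsub>M\<^esub>"
    using add.IH(2) by metis
  show ?case
  proof (rule exI[of _ "F \<union> F'"], rule exI[of _ "U \<inter> V"], intro conjI allI impI)
    show "subgroup (U \<inter> V) N" by (rule N.subgroups_Inter_pair[OF 1(3) 2(3)])
    fix K U' assume a: "subgroup K N" "compactin \<T> K" "F \<union> F' \<subseteq> K" "subgroup U' N" "openin \<T> U'"
      "U' \<subseteq> K" "U' \<subseteq> U \<inter> V" "\<forall>g\<in>K. \<forall>x\<in>U'. g \<otimes> x \<otimes> inv g \<in> U'"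
    have "coset_sum K U' v = \<zero>\<^bsub>M\<^esub>" "coset_sum K U' w = \<zero>\<^bsub>M\<^esub>" using 1(5) 2(5) a by auto
    then show "coset_sum K U' (v \<oplus>\<^bsub>M\<^esub> w) = \<zero>\<^bsub>M\<^esub>"
      using coset_sum_add[OF a(1,4,6)] add.hyps augmentation_closed by simp
  qed (use 1 2 in auto)
next
  case (smult a v)
  obtain F U where 1: "finite F" "F \<subseteq> carrier N" "subgroup U N" "openin \<T> U"
    "\<And>K U'. \<lbrakk>subgroup K N; compactin \<T> K; F \<subseteq> K; subgroup U' N; openin \<T> U'; U' \<subseteq> K; U' \<subseteq> U;
      \<forall>g\<in>K. \<forall>x\<in>U'. g \<otimes> x \<otimes> inv g \<in> U'\<rbrakk> \<Longrightarrow> coset_sum K U' v = \<zero>\<^bsub>M\<^esub>"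
    using smult.IH by metis
  show ?case
  proof (rule exI[of _ F], rule exI[of _ U], intro conjI allI impI)
    fix K U' assume a: "subgroup K N" "compactin \<T> K" "F \<subseteq> K" "subgroup U' N" "openin \<T> U'"
      "U' \<subseteq> K" "U' \<subseteq> U" "\<forall>g\<in>K. \<forall>x\<in>U'. g \<otimes> x \<otimes> inv g \<in> U'"
    have "coset_sum K U' v = \<zero>\<^bsub>M\<^esub>" using 1(5) a by auto
    then show "coset_sum K U' (a \<odot>\<^bsub>M\<^esub> v) = \<zero>\<^bsub>M\<^esub>"
      using coset_sum_smult[OF a(1,4,6) finite_rcosets_compact[OF a(1,2,4-6)] smult.hyps(1)]
        smult.hyps augmentation_closed by simp
  qed (use 1 in auto)
qed

text \<open>Each translate of \<open>v\<close> is congruent to \<open>v\<close>.\<close>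

lemma augmentation_sum_congruence:
  assumes "finite S" "v \<in> carrier M" "\<And>C. C \<in> S \<Longrightarrow> h C \<in> carrier N"
  shows "([card S] \<cdot>\<^bsub>A\<^esub> \<one>\<^bsub>A\<^esub>) \<odot>\<^bsub>M\<^esub> v \<ominus>\<^bsub>M\<^esub> (\<Oplus>\<^bsub>M\<^esub>C\<in>S. \<sigma> (h C) v) \<in> augmentation"
  using assms(1,3)
proof (induction S rule: finite_induct)
  case empty
  show ?case
    using M.submoduleE(2)[OF augmentation_submodule] assms(2)
      subgroup.one_closed[OF Module.submodule.axioms(1)[OF augmentation_submodule]]
    by (simp add: M.minus_eq minus_zero_M)
next
  case (insert C S)
  let ?m = "[card S] \<cdot>\<^bsub>A\<^esub> \<one>\<^bsub>A\<^esub>" and ?s = "\<Oplus>\<^bsub>M\<^esub>C\<in>S. \<sigma> (h C) v"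
  note E = M.submoduleE[OF augmentation_submodule]
  have m: "?m \<in> carrier A" by simp
  have s: "?s \<in> carrier M" using insert.prems assms(2) by (intro M.finsum_closed) auto
  have x: "\<sigma> (h C) v \<in> carrier M" using insert.prems assms(2) by simp
  have "(?m \<odot>\<^bsub>M\<^esub> v \<ominus>\<^bsub>M\<^esub> ?s) \<oplus>\<^bsub>M\<^esub> (\<ominus>\<^bsub>M\<^esub> (\<sigma> (h C) v \<ominus>\<^bsub>M\<^esub> v)) \<in> augmentation"
    using insert assms(2) by (intro E(5) E(3) augmentation.diff) auto
  also have "(?m \<odot>\<^bsub>M\<^esub> v \<ominus>\<^bsub>M\<^esub> ?s) \<oplus>\<^bsub>M\<^esub> (\<ominus>\<^bsub>M\<^esub> (\<sigma> (h C) v \<ominus>\<^bsub>M\<^esub> v))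
      = (?m \<odot>\<^bsub>M\<^esub> v \<oplus>\<^bsub>M\<^esub> v) \<ominus>\<^bsub>M\<^esub> (\<sigma> (h C) v \<oplus>\<^bsub>M\<^esub> ?s)"
    using m s x assms(2) by (simp add: M.minus_eq M.minus_add M.a_ac)
  also have "?m \<odot>\<^bsub>M\<^esub> v \<oplus>\<^bsub>M\<^esub> v = ([card (insert C S)] \<cdot>\<^bsub>A\<^esub> \<one>\<^bsub>A\<^esub>) \<odot>\<^bsub>M\<^esub> v"
    using insert.hyps assms(2) m by (simp add: M.smult_l_distr)
  also have "\<sigma> (h C) v \<oplus>\<^bsub>M\<^esub> ?s = (\<Oplus>\<^bsub>M\<^esub>C\<in>insert C S. \<sigma> (h C) v)"
    using insert assms(2) by (subst M.finsum_insert) auto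
  finally show ?case .
qed

text \<open>The coinvariants have no \<open>a\<close>-torsion if \<open>M\<close> has none: a sum over cosets detects membership in
  the augmentation submodule, up to the index, which is a unit.\<close>

lemma augmentation_pure:
  assumes ex: "exhausted_by_compact_subgroups A N \<T>"
    and a: "a \<in> carrier A" "\<And>x. x \<in> carrier M \<Longrightarrow> a \<odot>\<^bsub>M\<^esub> x = \<zero>\<^bsub>M\<^esub> \<Longrightarrow> x = \<zero>\<^bsub>M\<^esub>"
    and v: "v \<in> carrier M" and av: "a \<odot>\<^bsub>M\<^esub> v \<in> augmentation"
  shows "v \<in> augmentation"
proof -
  obtain F U\<^sub>0 where F: "finite F" "F \<subseteq> carrier N" "subgroup U\<^sub>0 N" "openin \<T> U\<^sub>0"
    "\<And>K U. \<lbrakk>subgroup K N; compactin \<T> K; F \<subseteq> K; subgroup U N; openin \<T> U; U \<subseteq> K; U \<subseteq> U\<^sub>0;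
      \<forall>g\<in>K. \<forall>x\<in>U. g \<otimes> x \<otimes> inv g \<in> U\<rbrakk> \<Longrightarrow> coset_sum K U (a \<odot>\<^bsub>M\<^esub> v) = \<zero>\<^bsub>M\<^esub>"
    using coset_sum_augmentation_eventually_zero[OF av] by metis
  have "compactin \<T> F" using F(1,2) topspace_eq by (simp add: finite_imp_compactin)
  then obtain K where K: "subgroup K N" "compactin \<T> K" "openin \<T> K" "F \<subseteq> K"
    "invertible_pro_order A (N\<lparr>carrier := K\<rparr>) (subtopology \<T> K)"
    using ex unfolding exhausted_by_compact_subgroups_def by blast
  obtain U where U: "subgroup U N" "openin \<T> U" "U \<subseteq> U\<^sub>0" "U \<subseteq> K"
    "\<forall>g\<in>K. \<forall>x\<in>U. g \<otimes> x \<otimes> inv g \<in> U"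
    using open_normal_core[OF K(1-3) F(3,4)] by blast
  let ?RC = "rcosets\<^bsub>N\<lparr>carrier := K\<rparr>\<^esub> U"
  have fin: "finite ?RC" by (rule finite_rcosets_compact[OF K(1,2) U(1,2,4)])
  have "a \<odot>\<^bsub>M\<^esub> coset_sum K U v = \<zero>\<^bsub>M\<^esub>"
    using F(5)[OF K(1,2,4) U(1,2,4,3,5)] coset_sum_smult[OF K(1) U(1,4) fin a(1) v] by simp
  then have zero: "coset_sum K U v = \<zero>\<^bsub>M\<^esub>"
    using a(2) coset_sum_closed[OF K(1) U(1,4) v] by blast
  let ?m = "[card ?RC] \<cdot>\<^bsub>A\<^esub> \<one>\<^bsub>A\<^esub>"
  have "subgroup U (N\<lparr>carrier := K\<rparr>)" using subgroup_incl[OF U(1) K(1) U(4)] .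
  moreover have "openin (subtopology \<T> K) U" using U(2,4) by (auto simp: openin_subtopology)
  ultimately have m: "?m \<in> Units A"
    using K(5) unfolding invertible_pro_order_def by blast
  have "?m \<odot>\<^bsub>M\<^esub> v \<ominus>\<^bsub>M\<^esub> coset_sum K U v \<in> augmentation"
    unfolding coset_sum_def
    by (rule augmentation_sum_congruence[OF fin v])
       (use coset_sum_summand_closed(1)[OF K(1) U(1,4)] in simp)
  then have "?m \<odot>\<^bsub>M\<^esub> v \<in> augmentation" using zero v by (simp add: M.minus_eq minus_zero_M)
  from augmentation.smult[OF _ this, of "inv\<^bsub>A\<^esub> ?m"]
  have "inv\<^bsub>A\<^esub> ?m \<odot>\<^bsub>M\<^esub> (?m \<odot>\<^bsub>M\<^esub> v) \<in> augmentation"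
    using m by simp
  moreover have "inv\<^bsub>A\<^esub> ?m \<odot>\<^bsub>M\<^esub> (?m \<odot>\<^bsub>M\<^esub> v) = v"
    using m v by (simp add: M.smult_assoc1[symmetric])
  ultimately show ?thesis by (simp only:)
qed

end

section \<open>Linear forms on an extension of scalars\<close>

lemma (in tensor_setting) pure_tensor_eqs:
  assumes "x \<in> carrier M" "y \<in> carrier M" "q \<in> carrier P" "r \<in> carrier R"
  shows "pure_tensor R M P (x \<oplus>\<^bsub>M\<^esub> y) q
      = pure_tensor R M P x q \<otimes>\<^bsub>tensor_group R M P\<^esub> pure_tensor R M P y q"
    and "pure_tensor R M P (r \<odot>\<^bsub>M\<^esub> x) q = pure_tensor R M P x (r \<odot>\<^bsub>P\<^esub> q)"
    and "pure_tensor R M P x q \<in> carrier (tensor_group R M P)"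
proof -
  have F: "frag_of (x, q) \<in> carrier F" if "x \<in> carrier M" "q \<in> carrier P" for x q
    using that by (simp add: free_Abelian_group_def)
  have 1: "frag_of (x \<oplus>\<^bsub>M\<^esub> y, q) - frag_of (x, q) - frag_of (y, q) \<in> H"
    by (rule rel_in_H) (use assms in \<open>auto simp: tensor_relations_def\<close>)
  show "pure_tensor R M P (x \<oplus>\<^bsub>M\<^esub> y) q
      = pure_tensor R M P x q \<otimes>\<^bsub>tensor_group R M P\<^esub> pure_tensor R M P y q"
    unfolding pure_tensor_def mult_tg[OF F[OF assms(1,3)] F[OF assms(2,3)]]
    by (rule coset_eqI) (use 1 in \<open>simp add: algebra_simps\<close>)
  show "pure_tensor R M P (r \<odot>\<^bsub>M\<^esub> x) q = pure_tensor R M P x (r \<odot>\<^bsub>P\<^esub> q)"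
    unfolding pure_tensor_def
    by (rule coset_eqI, rule rel_in_H) (use assms in \<open>auto simp: tensor_relations_def\<close>)
  show "pure_tensor R M P x q \<in> carrier (tensor_group R M P)"
    unfolding carrier_tg pure_tensor_def using F[OF assms(1,3)] by blast
qed

text \<open>Half of the adjunction between extension and restriction of scalars.\<close>

lemma base_change_restrict_hom:
  assumes M: "Module.module R M" and S: "cring S" and \<phi>: "\<phi> \<in> ring_hom R S"
    and T: "T \<in> module_hom S (base_change R S \<phi> M) (restrict_scalars S (\<lambda>a. a))"
  shows "(\<lambda>v. T (pure_tensor R M (restrict_scalars S \<phi>) v \<one>\<^bsub>S\<^esub>))
    \<in> module_hom R M (restrict_scalars S \<phi>)"
proof -
  interpret S: cring S by fact
  have R: "cring R" using M by (simp add: Module.module_def)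
  let ?P = "restrict_scalars S \<phi>"
  interpret tensor_setting R M ?P
    using M restrict_scalars_module[OF R S \<phi>] by (simp add: tensor_setting_def)
  note h = ring_hom_closed[OF \<phi>] ring_hom_add[OF \<phi>] ring_hom_mult[OF \<phi>] ring_hom_one[OF \<phi>]
  have one: "\<one>\<^bsub>S\<^esub> \<in> carrier ?P" by (simp add: restrict_scalars_def)
  let ?t = "\<lambda>v. pure_tensor R M ?P v \<one>\<^bsub>S\<^esub>"
  have cl: "?t v \<in> carrier (base_change R S \<phi> M)" if "v \<in> carrier M" for v
    using pure_tensor_eqs(3)[OF that that one, of "\<zero>\<^bsub>R\<^esub>"] by (simp add: base_change_def)
  have ad: "?t (v \<oplus>\<^bsub>M\<^esub> w) = ?t v \<oplus>\<^bsub>base_change R S \<phi> M\<^esub> ?t w"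
    if "v \<in> carrier M" "w \<in> carrier M" for v w
    using pure_tensor_eqs(1)[OF that one, of "\<zero>\<^bsub>R\<^esub>"] by (simp add: base_change_def)
  have sm: "?t (r \<odot>\<^bsub>M\<^esub> v) = \<phi> r \<odot>\<^bsub>base_change R S \<phi> M\<^esub> ?t v"
    if r: "r \<in> carrier R" and v: "v \<in> carrier M" for r v
  proof -
    have "?t (r \<odot>\<^bsub>M\<^esub> v) = pure_tensor R M ?P v (\<phi> r \<otimes>\<^bsub>S\<^esub> \<one>\<^bsub>S\<^esub>)"
      using pure_tensor_eqs(2)[OF v v one r] by (simp add: restrict_scalars_def)
    also have "\<dots> = \<phi> r \<odot>\<^bsub>base_change R S \<phi> M\<^esub> ?t v"
      unfolding base_change_def pure_tensor_def
      by simp (subst tensor_map_coset, auto simp: restrict_scalars_def S.r_distr h S.m_ac r)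
    finally show ?thesis .
  qed
  show ?thesis
    using T cl ad sm h unfolding module_hom_def restrict_scalars_def by auto
qed

lemma base_change_action_pure_tensor:
  assumes M: "Module.module R M" and S: "cring S" and \<phi>: "\<phi> \<in> ring_hom R S"
    and f: "\<rho> n \<in> module_hom R M M" and s: "s \<in> carrier S"
  shows "base_change_action R S \<phi> M \<rho> n (pure_tensor R M (restrict_scalars S \<phi>) v s)
    = pure_tensor R M (restrict_scalars S \<phi>) (\<rho> n v) s"
proof -
  have R: "cring R" using M by (simp add: Module.module_def)
  interpret tensor_setting R M "restrict_scalars S \<phi>"
    using M restrict_scalars_module[OF R S \<phi>] by (simp add: tensor_setting_def)
  show ?thesis
    unfolding base_change_action_def pure_tensor_def
    by (subst tensor_map_coset) (use f in \<open>auto simp: module_hom_def\<close>)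
qed

section \<open>Lifting equivariant linear forms\<close>

theorem lemma2p4:
  fixes A :: "('a, 'b) ring_scheme"
    and K :: "('k, 'c) ring_scheme"
    and \<iota> :: "'a \<Rightarrow> 'k"
    and N :: "('g, 'd) monoid_scheme"
    and \<T> :: "'g topology"
    and \<psi> :: "'g \<Rightarrow> 'a"
    and V :: "('a, 'v, 'e) module_scheme"
    and \<rho> :: "'g \<Rightarrow> 'v \<Rightarrow> 'v"
    and T :: "('v \<times> 'a set \<Rightarrow>\<^sub>0 int) set \<Rightarrow> 'a set"
  assumes "complete_discrete_valuation_ring A"
    and "fraction_field A K \<iota>"
    and "locally_profinite_group N \<T>"
    and "exhausted_by_compact_subgroups A N \<T>"
    and "smooth_character A N \<T> \<psi>"
    and "smooth_module A N \<T> V \<rho>"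
    and "torsion_free A V"
    and "countable_dimension K (base_change A K \<iota> V)"
    and "T \<in> equivariant_forms (residue_field A) N
               (base_change A (residue_field A) (residue_map A) V)
               (base_change_action A (residue_field A) (residue_map A) V \<rho>)
               (\<lambda>n. residue_map A (\<psi> n))"
  shows "\<exists>T'\<in>equivariant_forms A N V \<rho> \<psi>. \<forall>v\<in>carrier V.
           T (pure_tensor A V (restrict_scalars (residue_field A) (residue_map A))
                v \<one>\<^bsub>residue_field A\<^esub>)
           = residue_map A (T' v)"
proof -
  interpret A: complete_discrete_valuation_ring A by fact
  interpret N: locally_profinite_group N \<T> by fact
  have V: "Module.module A V" and act: "group_action N (carrier V) \<rho>"
    and \<rho>_hom: "\<And>n. n \<in> carrier N \<Longrightarrow> \<rho> n \<in> module_hom A V V"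
    and stab: "\<And>v. v \<in> carrier V \<Longrightarrow> openin \<T> (stabilizer N \<rho> v)"
    using assms(6) unfolding smooth_module_def by blast+
  interpret V: Module.module A V by (rule V)
  interpret act: group_action N "carrier V" \<rho> by (rule act)
  have dvr: "discrete_valuation_ring A" by unfold_locales
  note res = residue_field_facts[OF dvr]
  interpret k: field "residue_field A" by (rule res(2))
  note rh = ring_hom_closed[OF res(3)] ring_hom_add[OF res(3)] ring_hom_mult[OF res(3)] ring_hom_one[OF res(3)]
  have \<psi>_hom: "\<psi> \<in> hom N (units_of A)" and \<psi>_ker: "openin \<T> (kernel N (units_of A) \<psi>)"
    using assms(5) unfolding smooth_character_def by blast+
  interpret \<psi>: group_hom N "units_of A" \<psi>
    using \<psi>_hom A.units_group by (simp add: group_hom_def group_hom_axioms_def N.is_group)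
  have \<psi>_unit: "\<psi> n \<in> Units A" if "n \<in> carrier N" for n
    using \<psi>.hom_closed[OF that] by (simp add: units_of_carrier)
  have \<psi>_A: "\<psi> n \<in> carrier A" if "n \<in> carrier N" for n
    using \<psi>_unit[OF that] by (rule A.Units_closed)
  \<comment> \<open>For the twisted action, equivariance becomes invariance.\<close>
  define \<sigma> where "\<sigma> n v = inv\<^bsub>A\<^esub> (\<psi> n) \<odot>\<^bsub>V\<^esub> \<rho> n v" for n v
  have iA: "inv\<^bsub>A\<^esub> (\<psi> n) \<in> carrier A" if "n \<in> carrier N" for n
    using \<psi>_unit[OF that] by simp
  have \<rho>c: "\<rho> n v \<in> carrier V" if "n \<in> carrier N" "v \<in> carrier V" for n v
    using module_hom_closed[OF \<rho>_hom[OF that(1)]] that(2) by blast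
  have \<rho>_eq: "\<rho> n v = \<psi> n \<odot>\<^bsub>V\<^esub> \<sigma> n v" if "n \<in> carrier N" "v \<in> carrier V" for n v
    unfolding \<sigma>_def using \<psi>_unit[OF that(1)] \<rho>c[OF that] \<psi>_A[OF that(1)]
    by (simp add: V.smult_assoc1[symmetric])
  interpret \<sigma>: smooth_linear_action N \<T> A V \<sigma>
  proof (unfold_locales, goal_cases)
    case (1 n)
    show ?case
      using 1 iA[OF 1] module_hom_add[OF \<rho>_hom[OF 1]] module_hom_smult[OF \<rho>_hom[OF 1]] \<rho>c[OF 1]
      unfolding module_hom_def \<sigma>_def
      by (simp add: V.smult_r_distr V.smult_assoc1[symmetric] A.m_comm)
  next
    case (2 v)
    have "\<rho> \<one>\<^bsub>N\<^esub> v = v" using act.id_eq_one 2 by (metis restrict_apply')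
    then show ?case unfolding \<sigma>_def using 2 by (simp add: units_of_one)
  next
    case (3 g h v)
    have "inv\<^bsub>A\<^esub> (\<psi> g \<otimes>\<^bsub>A\<^esub> \<psi> h) = inv\<^bsub>A\<^esub> (\<psi> g) \<otimes>\<^bsub>A\<^esub> inv\<^bsub>A\<^esub> (\<psi> h)"
    proof (rule A.comm_inv_char)
      have "\<psi> g \<otimes>\<^bsub>A\<^esub> \<psi> h \<otimes>\<^bsub>A\<^esub> (inv\<^bsub>A\<^esub> (\<psi> g) \<otimes>\<^bsub>A\<^esub> inv\<^bsub>A\<^esub> (\<psi> h))
          = (\<psi> g \<otimes>\<^bsub>A\<^esub> inv\<^bsub>A\<^esub> (\<psi> g)) \<otimes>\<^bsub>A\<^esub> (\<psi> h \<otimes>\<^bsub>A\<^esub> inv\<^bsub>A\<^esub> (\<psi> h))"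
        using \<psi>_A iA 3(1,2) by (simp add: A.m_ac)
      then show "\<psi> g \<otimes>\<^bsub>A\<^esub> \<psi> h \<otimes>\<^bsub>A\<^esub> (inv\<^bsub>A\<^esub> (\<psi> g) \<otimes>\<^bsub>A\<^esub> inv\<^bsub>A\<^esub> (\<psi> h)) = \<one>\<^bsub>A\<^esub>"
        using \<psi>_unit 3(1,2) by simp
    qed (use \<psi>_A iA 3(1,2) in simp_all)
    moreover have "\<rho> (g \<otimes>\<^bsub>N\<^esub> h) v = \<rho> g (\<rho> h v)"
      using act.composition_rule[OF 3(3,1,2)] .
    ultimately show ?case
      unfolding \<sigma>_def using 3 iA \<rho>c module_hom_smult[OF \<rho>_hom[OF 3(1)] iA[OF 3(2)] \<rho>c[OF 3(2,3)]]
      by (simp add: units_of_mult V.smult_assoc1)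
  next
    case (4 v)
    \<comment> \<open>A vector is fixed by the twisted action of those elements that fix it and lie in the kernel of
      the character.\<close>
    let ?U = "stabilizer N \<rho> v \<inter> kernel N (units_of A) \<psi>"
    have "subgroup ?U N"
      using N.subgroups_Inter_pair[OF act.stabilizer_subgroup[OF 4] \<psi>.subgroup_kernel] .
    moreover have "openin \<T> ?U" using stab[OF 4] \<psi>_ker by blast
    moreover have "\<sigma> u v = v" if "u \<in> ?U" for u
      using that 4 unfolding \<sigma>_def stabilizer_def kernel_def by (simp add: units_of_one)
    ultimately show ?case by blast
  qed
  have T: "T \<in> module_hom (residue_field A) (base_change A (residue_field A) (residue_map A) V)
      (restrict_scalars (residue_field A) (\<lambda>a. a))"
    and T_eq: "\<And>n x. n \<in> carrier N \<Longrightarrow> x \<in> carrier (base_change A (residue_field A) (residue_map A) V) \<Longrightarrow>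
      T (base_change_action A (residue_field A) (residue_map A) V \<rho> n x)
      = residue_map A (\<psi> n) \<otimes>\<^bsub>residue_field A\<^esub> T x"
    using assms(9) unfolding equivariant_forms_def by blast+
  define t where "t v = T (pure_tensor A V (restrict_scalars (residue_field A) (residue_map A)) v
      \<one>\<^bsub>residue_field A\<^esub>)" for v
  have t: "t \<in> module_hom A V (restrict_scalars (residue_field A) (residue_map A))"
    unfolding t_def[abs_def]
    by (rule base_change_restrict_hom[OF V k.is_cring res(3) T])
  have tc: "t v \<in> carrier (residue_field A)" if "v \<in> carrier V" for v
    using module_hom_closed[OF t] that by (auto simp: restrict_scalars_def)
  have ta: "t (v \<oplus>\<^bsub>V\<^esub> w) = t v \<oplus>\<^bsub>residue_field A\<^esub> t w" if "v \<in> carrier V" "w \<in> carrier V" for v w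
    using module_hom_add[OF t that] by (simp add: restrict_scalars_def)
  have ts: "t (a \<odot>\<^bsub>V\<^esub> v) = residue_map A a \<otimes>\<^bsub>residue_field A\<^esub> t v"
    if "a \<in> carrier A" "v \<in> carrier V" for a v
    using module_hom_smult[OF t that] by (simp add: restrict_scalars_def)
  have t_\<rho>: "t (\<rho> n v) = residue_map A (\<psi> n) \<otimes>\<^bsub>residue_field A\<^esub> t v"
    if n: "n \<in> carrier N" and v: "v \<in> carrier V" for n v
  proof -
    let ?x = "pure_tensor A V (restrict_scalars (residue_field A) (residue_map A)) v \<one>\<^bsub>residue_field A\<^esub>"
    interpret ts: tensor_setting A V "restrict_scalars (residue_field A) (residue_map A)"
      using V restrict_scalars_module[OF A.is_cring k.is_cring res(3)] by (simp add: tensor_setting_def)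
    have "?x \<in> carrier (base_change A (residue_field A) (residue_map A) V)"
      using ts.pure_tensor_eqs(3)[OF v v, of "\<one>\<^bsub>residue_field A\<^esub>" "\<zero>\<^bsub>A\<^esub>"]
      by (simp add: base_change_def restrict_scalars_def)
    from T_eq[OF n this] show ?thesis
      unfolding t_def
      using base_change_action_pure_tensor[where \<rho> = \<rho> and n = n, OF V k.is_cring res(3) \<rho>_hom[OF n] k.one_closed] by simp
  qed
  have t_\<sigma>: "t (\<sigma> n v) = t v" if n: "n \<in> carrier N" and v: "v \<in> carrier V" for n v
  proof -
    have "t (\<sigma> n v) = residue_map A (inv\<^bsub>A\<^esub> (\<psi> n) \<otimes>\<^bsub>A\<^esub> \<psi> n) \<otimes>\<^bsub>residue_field A\<^esub> t v"
      unfolding \<sigma>_def using n v iA \<psi>_A \<rho>c tc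
      by (simp add: ts t_\<rho> rh k.m_assoc)
    then show ?thesis using \<psi>_unit[OF n] tc[OF v] by (simp add: rh)
  qed
  have t_zero: "t v = \<zero>\<^bsub>residue_field A\<^esub>" if "v \<in> \<sigma>.augmentation" for v
    using that
  proof induction
    case (diff n v)
    have "t (\<sigma> n v) = t ((\<sigma> n v \<ominus>\<^bsub>V\<^esub> v) \<oplus>\<^bsub>V\<^esub> v)"
      using diff by (simp add: V.minus_eq V.a_assoc V.l_neg)
    also have "\<dots> = t (\<sigma> n v \<ominus>\<^bsub>V\<^esub> v) \<oplus>\<^bsub>residue_field A\<^esub> t v"
      using diff by (intro ta) auto
    finally have "t (\<sigma> n v \<ominus>\<^bsub>V\<^esub> v) \<oplus>\<^bsub>residue_field A\<^esub> t v = t v"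
      using t_\<sigma>[OF diff] by simp
    then show ?case using tc diff by (metis V.minus_closed \<sigma>.\<sigma>_closed k.add.r_cancel_one)
  next
    case (add v w)
    then show ?case using \<sigma>.augmentation_closed by (simp add: ta)
  next
    case (smult a v)
    then show ?case using \<sigma>.augmentation_closed by (simp add: ts rh)
  qed
  obtain p where p: "p \<in> carrier A" "max_ideal A = PIdl\<^bsub>A\<^esub> p" "p \<noteq> \<zero>\<^bsub>A\<^esub>"
    using A.uniformizer_exists by blast
  interpret L: lifting_problem A V p \<sigma>.augmentation t
  proof (intro lifting_problem.intro lifting_problem_axioms.intro)
    show "v \<in> \<sigma>.augmentation" if "v \<in> carrier V" "p \<odot>\<^bsub>V\<^esub> v \<in> \<sigma>.augmentation" for v
      by (rule \<sigma>.augmentation_pure[OF assms(4) p(1) _ that])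
         (use assms(7) p in \<open>auto simp: torsion_free_def\<close>)
  qed (use A.complete_discrete_valuation_ring_axioms V p \<sigma>.augmentation_submodule t t_zero in auto)
  obtain f where f: "f \<in> module_hom A V (restrict_scalars A (\<lambda>a. a))"
    "\<And>w. w \<in> \<sigma>.augmentation \<Longrightarrow> f w = \<zero>\<^bsub>A\<^esub>" "\<And>v. v \<in> carrier V \<Longrightarrow> t v = residue_map A (f v)"
    using L.residual_form_lifts by blast
  have fc: "f v \<in> carrier A" if "v \<in> carrier V" for v
    using module_hom_closed[OF f(1)] that by (auto simp: restrict_scalars_def)
  have fa: "f (v \<oplus>\<^bsub>V\<^esub> w) = f v \<oplus>\<^bsub>A\<^esub> f w" if "v \<in> carrier V" "w \<in> carrier V" for v w
    using module_hom_add[OF f(1) that] by (simp add: restrict_scalars_def)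
  have fs: "f (a \<odot>\<^bsub>V\<^esub> v) = a \<otimes>\<^bsub>A\<^esub> f v" if "a \<in> carrier A" "v \<in> carrier V" for a v
    using module_hom_smult[OF f(1) that] by (simp add: restrict_scalars_def)
  have "f (\<rho> n v) = \<psi> n \<otimes>\<^bsub>A\<^esub> f v" if n: "n \<in> carrier N" and v: "v \<in> carrier V" for n v
  proof -
    have "\<sigma> n v = (\<sigma> n v \<ominus>\<^bsub>V\<^esub> v) \<oplus>\<^bsub>V\<^esub> v"
      using n v by (simp add: V.minus_eq V.a_assoc V.l_neg)
    then have "f (\<sigma> n v) = f (\<sigma> n v \<ominus>\<^bsub>V\<^esub> v) \<oplus>\<^bsub>A\<^esub> f v"
      using fa[of "\<sigma> n v \<ominus>\<^bsub>V\<^esub> v" v] n v by simp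
    also have "\<dots> = f v"
      using f(2)[OF \<sigma>.augmentation.diff[OF n v]] fc[OF v] by simp
    finally show ?thesis
      using \<rho>_eq[OF n v] fs[OF \<psi>_A[OF n] \<sigma>.\<sigma>_closed[OF n v]] by simp
  qed
  then have "f \<in> equivariant_forms A N V \<rho> \<psi>"
    unfolding equivariant_forms_def using f(1) by blast
  then show ?thesis using f(3) unfolding t_def by blast
qed

end
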